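(* There exist an almost everywhere approximately differentiable homeomorphism $\Phi$ of the unit cube $Q=[0,1]^n$ onto itself with the Lusin property (N), and a compact set $A$ in the interior of $Q$, such that: (i) $\Phi=\mathrm{id}$ in a neighborhood of $\partial Q$; (ii) $|A|=2^{-n}$; (iii) $\Phi$ is the reflection $(x_1,\ldots,x_{n-1},x_n)\mapsto(x_1,\ldots,x_{n-1},1-x_n)$ on $A$, $\Phi(A)=A$, and $\Phi$ is a $C^\infty$-diffeomorphism outside $A$; (iv) at almost all points $x$ of the set $A$ the approximate derivative of $\Phi$ is the diagonal $n\times n$ matrix $\operatorname{ap}D\Phi(x)=\operatorname{diag}(1,1,\ldots,1,-1)$.
   Context: $|\cdot|$ is Lebesgue measure. A map has the Lusin property (N) if it maps sets of Lebesgue measure zero to sets of Lebesgue measure zero. A point $x\in\mathbb{R}^n$ is a density point of a measurable set $E\subset\mathbb{R}^n$ if $\lim_{\rho\to0}|E\cap B(x,\rho)|/|B(x,\rho)|=1$. A measurable function $f:E\to\mathbb{R}$ on a measurable set $E\subset\mathbb{R}^n$ is approximately differentiable at $x\in E$ if there are a measurable set $E_x\subset E$ and a linear function $L:\mathbb{R}^n\to\mathbb{R}$ such that $x$ is a density point of $E_x$ and $\lim_{E_x\ni y\to x}|f(y)-f(x)-L(y-x)|/|y-x|=0$; such $L$ is unique and denoted $\operatorname{ap}Df(x)$. A map into $\mathbb{R}^n$ is approximately differentiable at $x$ if each component is, and $\operatorname{ap}D\Phi(x)$ is the matrix whose rows are the approximate derivatives of the components. "$\Phi$ is a $C^\infty$-diffeomorphism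 outside $A$" means that $\Phi|_{Q\setminus A}$ is a $C^\infty$-diffeomorphism onto its image.
   Formalization: The dimension is assumed to be n ≥ 2; for n = 1 the claim is false, since a homeomorphism of [0,1] equal to the identity near the endpoints is increasing, whereas the reflection x ↦ 1−x reverses the order of any two points of A. *)

theory Defs
  imports "HOL-Analysis.Analysis"
begin

definition lusin_N_on :: "'a::euclidean_space set \<Rightarrow> ('a \<Rightarrow> 'b::euclidean_space) \<Rightarrow> bool" where
  "lusin_N_on S f \<longleftrightarrow>
     (\<forall>N. N \<subseteq> S \<and> N \<in> null_sets lebesgue \<longrightarrow> f ` N \<in> null_sets lebesgue)"

definition density_point :: "'a::euclidean_space \<Rightarrow> 'a set \<Rightarrow> bool" where
  "density_point x E \<longleftrightarrow> E \<in> sets lebesgue \<and>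
     ((\<lambda>\<rho>. measure lebesgue (E \<inter> ball x \<rho>) / measure lebesgue (ball x \<rho>)) \<longlongrightarrow> 1) (at_right 0)"

definition has_ap_derivative ::
  "('a::euclidean_space \<Rightarrow> real) \<Rightarrow> ('a \<Rightarrow> real) \<Rightarrow> 'a set \<Rightarrow> 'a \<Rightarrow> bool" where
  "has_ap_derivative f L E x \<longleftrightarrow>
     E \<in> sets lebesgue \<and> f \<in> borel_measurable (lebesgue_on E) \<and> x \<in> E \<and> linear L \<and>
     (\<exists>E\<^sub>x. E\<^sub>x \<in> sets lebesgue \<and> E\<^sub>x \<subseteq> E \<and> density_point x E\<^sub>x \<and>
        ((\<lambda>y. \<bar>f y - f x - L (y - x)\<bar> / norm (y - x)) \<longlongrightarrow> 0) (at x within E\<^sub>x))"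

definition ap_differentiable :: "('a::euclidean_space \<Rightarrow> real) \<Rightarrow> 'a set \<Rightarrow> 'a \<Rightarrow> bool" where
  "ap_differentiable f E x \<longleftrightarrow> (\<exists>L. has_ap_derivative f L E x)"

text \<open>The approximate derivative is unique when it exists; otherwise the value is unspecified.\<close>

definition ap_D :: "('a::euclidean_space \<Rightarrow> real) \<Rightarrow> 'a set \<Rightarrow> 'a \<Rightarrow> 'a \<Rightarrow> real" where
  "ap_D f E x = (THE L. has_ap_derivative f L E x)"

definition ap_differentiable_map :: "(real^'n \<Rightarrow> real^'m) \<Rightarrow> (real^'n) set \<Rightarrow> real^'n \<Rightarrow> bool" where
  "ap_differentiable_map f E x \<longleftrightarrow> (\<forall>i. ap_differentiable (\<lambda>y. f y $ i) E x)"

definition ap_D_matrix :: "(real^'n \<Rightarrow> real^'m) \<Rightarrow> (real^'n) set \<Rightarrow> real^'n \<Rightarrow> real^'n^'m" where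
  "ap_D_matrix f E x = (\<chi> i j. ap_D (\<lambda>y. f y $ i) E x (axis j 1))"

text \<open>\<open>C\<^sup>k\<close> on an open set: all iterated directional derivatives up to order \<open>k\<close> exist and are
  continuous, those of order less than \<open>k\<close> being moreover differentiable.\<close>

primrec Ck_on :: "nat \<Rightarrow> ('a::euclidean_space \<Rightarrow> 'b::euclidean_space) \<Rightarrow> 'a set \<Rightarrow> bool" where
  "Ck_on 0 f U \<longleftrightarrow> continuous_on U f"
| "Ck_on (Suc k) f U \<longleftrightarrow>
     (\<forall>x\<in>U. f differentiable (at x)) \<and>
     (\<forall>v. Ck_on k (\<lambda>x. frechet_derivative f (at x) v) U)"

text \<open>Smoothness on an arbitrary set means that locally there is a smooth extension to an open set.
  For open sets this is the usual notion; the cube minus a compact subset of its interior is not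
  open, as it contains the boundary of the cube.\<close>

definition smooth_on :: "('a::euclidean_space \<Rightarrow> 'b::euclidean_space) \<Rightarrow> 'a set \<Rightarrow> bool" where
  "smooth_on f S \<longleftrightarrow>
     (\<forall>x\<in>S. \<exists>U g. open U \<and> x \<in> U \<and> (\<forall>k. Ck_on k g U) \<and> (\<forall>y\<in>U \<inter> S. g y = f y))"

definition smooth_diffeomorphism ::
  "('a::euclidean_space \<Rightarrow> 'b::euclidean_space) \<Rightarrow> 'a set \<Rightarrow> 'b set \<Rightarrow> bool" where
  "smooth_diffeomorphism f S T \<longleftrightarrow>
     (\<exists>g. homeomorphism S T f g \<and> smooth_on f S \<and> smooth_on g T)"

definition unit_cube :: "(real^'n) set" where
  "unit_cube = {x. \<forall>i. 0 \<le> x $ i \<and> x $ i \<le> 1}"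

text \<open>The \<open>n\<close>-th coordinate is the one with the greatest index.\<close>

definition last_index :: "'n::{finite,linorder}" where
  "last_index = Max UNIV"

definition reflection :: "(real, 'n::{finite,linorder}) vec \<Rightarrow> (real, 'n) vec" where
  "reflection x = (\<chi> i. if i = last_index then 1 - x $ i else x $ i)"

definition reflection_matrix :: "((real, 'n::{finite,linorder}) vec, 'n) vec" where
  "reflection_matrix =
     (\<chi> i j. if i = j then (if i = last_index then -1 else 1) else 0)"

end

theory Submission
  imports Defs
begin

text \<open>\<open>A\<close> is the \<open>n\<close>-th power of a symmetric Cantor set of measure \<open>1/2\<close>, the intersection of levels
  that consist of \<open>2 ^ (k * n)\<close> disjoint cubes. The map is the limit of \<open>Phi k = F 0 \<circ> \<dots> \<circ> F (k - 1)\<close>,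
  where the smooth diffeomorphism \<open>F k\<close> is the identity off the cubes of level \<open>k\<close>, maps each of them
  to itself and permutes the cubes of level \<open>k + 1\<close> rigidly, so that \<open>Phi k\<close> moves every cube of
  level \<open>k\<close> rigidly onto its mirror image. Off level \<open>k\<close> the sequence is constant from \<open>Phi k\<close> on,
  which gives smoothness off \<open>A\<close>; as the diameters of the cubes tend to 0, the limit is a
  homeomorphism that agrees with the reflection on \<open>A\<close>. Almost every point of \<open>A\<close> is a density
  point of \<open>A\<close>, and there the approximate derivative is that of the reflection.\<close>

section \<open>Closure properties of \<open>Ck\<close> functions\<close>

text \<open>The obstacle is orientation. A diffeomorphism of the cube that is the identity near the
  boundary preserves orientation, so no smooth stage can reflect a whole cube. Each stage therefore
  mirrors only the positions of the cubes and carries every single cube by a translation or a half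
  turn; what happens inside a cube is invisible in the limit, where only positions count. Half turns
  take place in a plane, whence the auxiliary axis \<open>i0\<close> and dimension at least two; in
  dimension one a homeomorphism that fixes both ends is increasing. The gaps between the cubes are
  the room in which the half turns are cut off. No bound on the derivatives of \<open>F k\<close>
  uniform in \<open>k\<close> is used: off \<open>A\<close> finitely many stages act near each
  point, and on \<open>A\<close> the map is the reflection itself.\<close>

lemma Ck_on_mono: "Ck_on k f U \<Longrightarrow> V \<subseteq> U \<Longrightarrow> Ck_on k f V"
  by (induction k arbitrary: f) (auto intro: continuous_on_subset)

lemma Ck_on_SucI:
  assumes "\<And>x. (f has_derivative f' x) (at x)" "\<And>v. Ck_on k (\<lambda>x. f' x v) UNIV"
  shows "Ck_on (Suc k) f UNIV"
proof -
  have "frechet_derivative f (at x) = f' x" for x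
    using assms(1) frechet_derivative_at by metis
  then show ?thesis
    using assms by (auto simp: differentiable_def)
qed

text \<open>Lowering the order passes to the derivatives until order 0, where differentiability
  yields continuity. The product, inverse and chain rules rely on it, because their derivative
  formulas contain the functions themselves.\<close>

lemma Ck_on_SucD: "Ck_on (Suc k) f U \<Longrightarrow> Ck_on k f U"
proof (induction k arbitrary: f)
  case 0
  then show ?case
    by (auto intro!: continuous_at_imp_continuous_on differentiable_imp_continuous_within)
next
  case (Suc k)
  then show ?case by (simp only: Ck_on.simps(2)) blast
qed

lemma Ck_on_has_derivative:
  "Ck_on (Suc k) f UNIV \<Longrightarrow> (f has_derivative frechet_derivative f (at x)) (at x)"
  by (simp flip: frechet_derivative_works)

lemma Ck_on_bounded_linear:
  assumes "bounded_linear h" "Ck_on k f UNIV"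
  shows "Ck_on k (\<lambda>x. h (f x)) UNIV"
  using assms(2)
proof (induction k arbitrary: f)
  case 0
  then show ?case
    using bounded_linear.continuous_on[OF assms(1)] by simp
next
  case (Suc k)
  then show ?case
    by (intro Ck_on_SucI[where f' = "\<lambda>x v. h (frechet_derivative f (at x) v)"]
          bounded_linear.has_derivative[OF assms(1)] Ck_on_has_derivative) auto
qed

lemma Ck_on_const: "Ck_on k (\<lambda>x. c) UNIV"
proof (induction k arbitrary: c)
  case (Suc k)
  then show ?case by (intro Ck_on_SucI[where f' = "\<lambda>x v. 0"]) auto
qed auto

lemma Ck_on_ident: "Ck_on k (\<lambda>x. x) UNIV"
proof (cases k)
  case (Suc m)
  then show ?thesis
    using Ck_on_SucI[where f' = "\<lambda>x v. v" and k = m] Ck_on_const by auto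
qed auto

lemma Ck_on_add:
  assumes "Ck_on k f UNIV" "Ck_on k g UNIV"
  shows "Ck_on k (\<lambda>x. f x + g x) UNIV"
  using assms
proof (induction k arbitrary: f g)
  case 0
  then show ?case by (simp add: continuous_on_add)
next
  case (Suc k)
  show ?case
    by (rule Ck_on_SucI, rule has_derivative_add)
       (use Suc in \<open>auto intro: Ck_on_has_derivative\<close>)
qed

lemma Ck_on_sum:
  assumes "\<And>i. i \<in> I \<Longrightarrow> Ck_on k (f i) UNIV"
  shows "Ck_on k (\<lambda>x. \<Sum>i\<in>I. f i x) UNIV"
  using assms
  by (induction I rule: infinite_finite_induct) (auto intro!: Ck_on_add simp: Ck_on_const)

lemma Ck_on_scaleR:
  assumes "Ck_on k a UNIV" "Ck_on k f UNIV"
  shows "Ck_on k (\<lambda>x. a x *\<^sub>R f x) UNIV"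
  using assms
proof (induction k arbitrary: a f)
  case 0
  then show ?case by (simp add: continuous_on_scaleR)
next
  case (Suc k)
  note D = Suc.prems[THEN Ck_on_SucD]
  show ?case
    by (rule Ck_on_SucI, rule has_derivative_scaleR)
       (use Suc D in \<open>auto intro!: Ck_on_has_derivative Ck_on_add Suc.IH\<close>)
qed

lemma Ck_on_mult:
  fixes f g :: "'a::euclidean_space \<Rightarrow> real"
  assumes "Ck_on k f UNIV" "Ck_on k g UNIV"
  shows "Ck_on k (\<lambda>x. f x * g x) UNIV"
  using Ck_on_scaleR[OF assms] by simp

lemma Ck_on_cmult:
  fixes f :: "'a::euclidean_space \<Rightarrow> real"
  assumes "Ck_on k f UNIV"
  shows "Ck_on k (\<lambda>x. c * f x) UNIV"
  using Ck_on_mult[OF Ck_on_const assms] .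

lemma Ck_on_minus:
  assumes "Ck_on k f UNIV"
  shows "Ck_on k (\<lambda>x. - f x) UNIV"
  by (intro Ck_on_bounded_linear[OF bounded_linear_minus[OF bounded_linear_ident]] assms)

lemma Ck_on_diff:
  assumes "Ck_on k f UNIV" "Ck_on k g UNIV"
  shows "Ck_on k (\<lambda>x. f x - g x) UNIV"
  using Ck_on_add[OF assms(1) Ck_on_minus[OF assms(2)]] by simp

lemma Ck_on_compose:
  fixes f :: "'a::euclidean_space \<Rightarrow> 'b::euclidean_space" and g :: "'b \<Rightarrow> 'c::euclidean_space"
  assumes "Ck_on k g UNIV" "Ck_on k f UNIV"
  shows "Ck_on k (\<lambda>x. g (f x)) UNIV"
  using assms
proof (induction k arbitrary: f g)
  case 0
  then show ?case by (auto intro: continuous_on_compose2)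
next
  case (Suc k)
  let ?f' = "\<lambda>x. frechet_derivative f (at x)" and ?g' = "\<lambda>y. frechet_derivative g (at y)"
  show ?case
  proof (rule Ck_on_SucI)
    show "((\<lambda>x. g (f x)) has_derivative (\<lambda>v. ?g' (f x) (?f' x v))) (at x)" for x
      using has_derivative_compose[OF Ck_on_has_derivative[OF Suc.prems(2)]
          Ck_on_has_derivative[OF Suc.prems(1)]] .
    fix v
    \<comment> \<open>The direction \<open>?f' x v\<close> varies with \<open>x\<close>, while
      \<open>Ck_on\<close> only controls derivatives in fixed directions; expanding in the basis
      separates the two.\<close>
    have "?g' y w = (\<Sum>b\<in>Basis. (w \<bullet> b) *\<^sub>R ?g' y b)" for y w
    proof -
      interpret linear "?g' y"
        using Ck_on_has_derivative[OF Suc.prems(1)] has_derivative_linear by blast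
      show ?thesis
        by (subst (1) euclidean_representation[symmetric, of w]) (simp only: sum scale)
    qed
    then have "(\<lambda>x. ?g' (f x) (?f' x v)) = (\<lambda>x. \<Sum>b\<in>Basis. (?f' x v \<bullet> b) *\<^sub>R ?g' (f x) b)"
      by blast
    moreover have "Ck_on k (\<lambda>x. \<Sum>b\<in>Basis. (?f' x v \<bullet> b) *\<^sub>R ?g' (f x) b) UNIV"
      using Suc.prems Ck_on_SucD[OF Suc.prems(2)]
      by (intro Ck_on_sum Ck_on_scaleR Suc.IH Ck_on_bounded_linear[OF bounded_linear_inner_left]) auto
    ultimately show "Ck_on k (\<lambda>x. ?g' (f x) (?f' x v)) UNIV"
      by simp
  qed
qed

lemma Ck_on_SucI_real:
  fixes f :: "real \<Rightarrow> real"
  assumes "\<And>x. (f has_field_derivative f' x) (at x)" "Ck_on k f' UNIV"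
  shows "Ck_on (Suc k) f UNIV"
proof (rule Ck_on_SucI[where f' = "\<lambda>x v. f' x * v"])
  show "(f has_derivative (\<lambda>v. f' x * v)) (at x)" for x
    using assms(1)[of x] by (simp add: has_field_derivative_def)
  show "Ck_on k (\<lambda>x. f' x * v) UNIV" for v
    by (intro Ck_on_mult assms Ck_on_const)
qed

lemma Ck_on_inverse:
  fixes f :: "'a::euclidean_space \<Rightarrow> real"
  assumes "Ck_on k f UNIV" "\<And>x. f x \<noteq> 0"
  shows "Ck_on k (\<lambda>x. inverse (f x)) UNIV"
  using assms
proof (induction k arbitrary: f)
  case 0
  then show ?case by (simp add: continuous_on_inverse)
next
  case (Suc k)
  note IH = Suc.IH[OF Ck_on_SucD[OF Suc.prems(1)] Suc.prems(2)]
  show ?case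
  proof (rule Ck_on_SucI)
    show "((\<lambda>x. inverse (f x)) has_derivative
        (\<lambda>v. - (inverse (f x) * frechet_derivative f (at x) v * inverse (f x)))) (at x)" for x
      by (intro Deriv.has_derivative_inverse Suc.prems Ck_on_has_derivative[OF Suc.prems(1)])
    show "Ck_on k (\<lambda>x. - (inverse (f x) * frechet_derivative f (at x) v * inverse (f x))) UNIV" for v
      using Suc.prems by (intro Ck_on_minus Ck_on_mult IH) auto
  qed
qed

section \<open>Smoothness of elementary functions and a smooth cutoff\<close>

lemma Ck_on_sin_cos: "Ck_on k (sin :: real \<Rightarrow> real) UNIV \<and> Ck_on k (cos :: real \<Rightarrow> real) UNIV"
proof (induction k)
  case 0
  show ?case by (auto intro: continuous_intros)
next
  case (Suc k)
  then show ?case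
    by (intro conjI Ck_on_SucI_real[OF DERIV_sin] Ck_on_SucI_real[OF DERIV_cos] Ck_on_minus) auto
qed

lemma Ck_on_sinh_cosh:
  "Ck_on k (sinh :: real \<Rightarrow> real) UNIV \<and> Ck_on k (cosh :: real \<Rightarrow> real) UNIV"
proof (induction k)
  case 0
  show ?case by (auto intro: continuous_intros)
next
  case (Suc k)
  have "(sinh has_field_derivative cosh x) (at x)" "(cosh has_field_derivative sinh x) (at x)"
    for x :: real
    by (auto intro!: derivative_eq_intros)
  then show ?case
    using Suc by (blast intro: Ck_on_SucI_real)
qed

text \<open>The derivative \<open>inverse (cosh (arsinh x))\<close> is expressed through
  \<open>arsinh\<close> itself, so the induction closes.\<close>

lemma Ck_on_arsinh: "Ck_on k (arsinh :: real \<Rightarrow> real) UNIV"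
proof (induction k)
  case 0
  show ?case by (auto intro: continuous_intros)
next
  case (Suc k)
  have "(arsinh has_field_derivative inverse (cosh (arsinh x))) (at x)" for x :: real
    by (auto intro!: derivative_eq_intros simp: cosh_arsinh_real inverse_eq_divide)
  moreover have "Ck_on k (\<lambda>x. inverse (cosh (arsinh x :: real))) UNIV"
    using Ck_on_sinh_cosh[of k] Suc
    by (intro Ck_on_inverse Ck_on_compose[of k cosh arsinh]) (simp_all add: less_imp_neq[symmetric])
  ultimately show ?case
    by (rule Ck_on_SucI_real)
qed

lemma Ck_on_nth: "Ck_on k f UNIV \<Longrightarrow> Ck_on k (\<lambda>x. f x $ i) UNIV"
  by (rule Ck_on_bounded_linear[OF bounded_linear_vec_nth])

lemma Ck_on_vec_lambda:
  fixes f :: "'a::euclidean_space \<Rightarrow> 'n::finite \<Rightarrow> real"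
  assumes "\<And>i. Ck_on k (\<lambda>x. f x i) UNIV"
  shows "Ck_on k (\<lambda>x. \<chi> i. f x i) UNIV"
proof -
  have "(\<chi> i. f x i) = (\<Sum>i\<in>UNIV. f x i *\<^sub>R axis i 1)" for x
    by (simp add: vec_eq_iff axis_def if_distrib cong: if_cong)
  then show ?thesis
    by (simp add: Ck_on_sum Ck_on_scaleR assms Ck_on_const)
qed

text \<open>The functions \<open>exp (-1/t) / t ^ m\<close>, extended by 0 to \<open>t \<le> 0\<close>, are closed under
  differentiation up to linear combinations; hence all of them are smooth.\<close>

lemma Ck_on_exp_inverse:
  "Ck_on k (\<lambda>t::real. if t > 0 then exp (- inverse t) * inverse t ^ m else 0) UNIV"
proof -
  let ?e = "\<lambda>m t::real. if t > 0 then exp (- inverse t) * inverse t ^ m else 0"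
  have lim: "((\<lambda>t. ?e m t) \<longlongrightarrow> 0) (at 0)" for m
  proof -
    have "((\<lambda>t. ?e m t) \<longlongrightarrow> 0) (at_right 0)"
    proof -
      \<comment> \<open>The substitution \<open>s = 1/t\<close> turns the behaviour at 0 from the
        right into decay at infinity.\<close>
      have "((\<lambda>s::real. s ^ m / exp s) \<longlongrightarrow> 0) at_top"
        by (rule tendsto_power_div_exp_0)
      then have "((\<lambda>t::real. inverse t ^ m / exp (inverse t)) \<longlongrightarrow> 0) (at_right 0)"
        by (rule filterlim_compose[OF _ filterlim_inverse_at_top_right])
      moreover have "\<forall>\<^sub>F t in at_right 0. inverse t ^ m / exp (inverse t) = ?e m t"
        by (simp add: eventually_at_right_less exp_minus field_simps eventually_at_filter)
      ultimately show ?thesis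
        by (rule Lim_transform_eventually)
    qed
    moreover have "((\<lambda>t. ?e m t) \<longlongrightarrow> 0) (at_left 0)"
      by (rule tendsto_eventually) (simp add: eventually_at_filter)
    ultimately show ?thesis
      by (simp add: filterlim_split_at)
  qed
  have der: "((\<lambda>t. ?e m t) has_field_derivative ?e (m + 2) t - m * ?e (m + 1) t) (at t)" for m t
  proof -
    consider "t > 0" | "t < 0" | "t = 0" by linarith
    then show ?thesis
    proof cases
      case 1
      have "m * (inverse t * inverse t ^ (m - 1)) = m * inverse t ^ m"
        by (cases m) auto
      then have "((\<lambda>t. exp (- inverse t) * inverse t ^ m) has_field_derivative
              ?e (m + 2) t - m * ?e (m + 1) t) (at t)"
        using 1 by (auto intro!: derivative_eq_intros simp: algebra_simps)
      then show ?thesis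
        by (rule has_field_derivative_transform_within_open[where S = "{0<..}"]) (use 1 in auto)
    next
      case 2
      have "((\<lambda>t. 0) has_field_derivative ?e (m + 2) t - m * ?e (m + 1) t) (at t)"
        using 2 by simp
      then show ?thesis
        by (rule has_field_derivative_transform_within_open[where S = "{..<0}"]) (use 2 in auto)
    next
      case 3
      \<comment> \<open>Off 0 this difference quotient is \<open>?e (Suc m)\<close>, another member
        of the family.\<close>
      have "((\<lambda>h. (?e m (0 + h) - ?e m 0) / h) \<longlongrightarrow> 0) (at 0)"
        by (rule Lim_transform_eventually[OF lim[of "Suc m"]])
           (auto simp: field_simps eventually_at_filter)
      then show ?thesis
        unfolding 3 DERIV_def by simp
    qed
  qed
  show ?thesis
  proof (induction k arbitrary: m)
    case 0
    have "isCont (?e m) t" for t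
      using der DERIV_isCont by blast
    then show ?case
      by (simp add: continuous_at_imp_continuous_on)
  next
    case (Suc k)
    show ?case
      by (rule Ck_on_SucI_real[OF der]) (intro Ck_on_diff Ck_on_cmult Suc.IH)
  qed
qed

text \<open>The usual quotient of one-sided flat functions; since \<alpha> < \<beta>, at every
  \<open>t\<close> at least one summand of the denominator is positive.\<close>

lemma smooth_cutoff:
  fixes \<alpha> \<beta> :: real
  assumes "\<alpha> < \<beta>"
  obtains \<eta> where "\<And>k. Ck_on k \<eta> UNIV" "\<And>t. t \<le> \<alpha> \<Longrightarrow> \<eta> t = 1" "\<And>t. t \<ge> \<beta> \<Longrightarrow> \<eta> t = (0::real)"
proof -
  define e where "e t = (if t > 0 then exp (- inverse t) else 0)" for t :: real
  have e: "Ck_on k e UNIV" for k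
    using Ck_on_exp_inverse[of k 0] unfolding e_def[abs_def] by (simp cong: if_cong)
  have pos: "e (\<beta> - t) + e (t - \<alpha>) \<noteq> 0" for t
    using assms by (auto simp: e_def add_nonneg_eq_0_iff)
  show thesis
  proof (rule that[of "\<lambda>t. e (\<beta> - t) * inverse (e (\<beta> - t) + e (t - \<alpha>))"])
    show "Ck_on k (\<lambda>t. e (\<beta> - t) * inverse (e (\<beta> - t) + e (t - \<alpha>))) UNIV" for k
      by (intro Ck_on_mult Ck_on_inverse Ck_on_add Ck_on_compose[OF e] Ck_on_diff Ck_on_const
          Ck_on_ident pos)
    show "e (\<beta> - t) * inverse (e (\<beta> - t) + e (t - \<alpha>)) = 1" if "t \<le> \<alpha>" for t
      using that assms by (simp add: e_def)
    show "e (\<beta> - t) * inverse (e (\<beta> - t) + e (t - \<alpha>)) = 0" if "t \<ge> \<beta>" for t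
      using that by (simp add: e_def)
  qed
qed

section \<open>Twisting boxes\<close>

text \<open>By the addition formula \<open>sinh (q * M)\<close> is at least
  \<open>sinh M * cosh ((q - 1) * M)\<close> for positive \<open>M\<close>, and the second factor is
  unbounded. With \<open>c\<close> the dimension and \<open>q\<close> a ratio of box widths, this
  fits a sphere between the images of the inner and the outer box.\<close>

lemma eventually_sinh_power2_less:
  fixes c q :: real
  assumes "q > 1"
  shows "\<forall>\<^sub>F M in at_top. c * sinh M ^ 2 < sinh (q * M) ^ 2"
proof -
  have "filterlim (\<lambda>M::real. (q - 1) * M) at_top at_top"
    using assms by (intro filterlim_tendsto_pos_mult_at_top[OF tendsto_const] filterlim_ident) auto
  then have "filterlim (\<lambda>M. cosh ((q - 1) * M)) at_top at_top"
    by (rule filterlim_compose[OF cosh_real_at_top])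
  then have "\<forall>\<^sub>F M in at_top. cosh ((q - 1) * M) > max 1 c"
    unfolding filterlim_at_top_dense by blast
  with eventually_gt_at_top[of 0] show ?thesis
  proof eventually_elim
    case (elim M)
    let ?C = "cosh ((q - 1) * M)"
    have "c < ?C * 1" using elim by simp
    also have "\<dots> \<le> ?C ^ 2"
      unfolding power2_eq_square using elim by (intro mult_left_mono) auto
    finally have c: "c < ?C ^ 2" .
    have "0 \<le> sinh M * ?C"
      using elim by simp
    moreover have "sinh M * ?C \<le> sinh M * ?C + cosh M * sinh ((q - 1) * M)"
      using elim assms by simp
    moreover have "\<dots> = sinh (q * M)"
      using sinh_add[of M "(q - 1) * M"] by (simp add: algebra_simps)
    ultimately have "(sinh M * ?C) ^ 2 \<le> sinh (q * M) ^ 2"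
      by (intro power_mono) auto
    moreover have "c * sinh M ^ 2 < (sinh M * ?C) ^ 2"
      using mult_strict_right_mono[OF c, of "sinh M ^ 2"] elim
      by (simp add: power_mult_distrib mult.commute)
    ultimately show ?case by linarith
  qed
qed

lemma sum_two_changed:
  fixes f g :: "'n::finite \<Rightarrow> real"
  assumes "i \<noteq> j" "f i + f j = g i + g j" "\<And>l. l \<noteq> i \<Longrightarrow> l \<noteq> j \<Longrightarrow> f l = g l"
  shows "sum f UNIV = sum g UNIV"
proof -
  have "sum h UNIV = h i + h j + sum h (UNIV - {i, j})" for h :: "'n \<Rightarrow> real"
    using sum.subset_diff[of "{i, j}" UNIV h] assms(1) by simp
  then show ?thesis
    using assms by (simp add: sum.cong[of "UNIV - {i, j}" _ f g])
qed

text \<open>Rotation of the coordinates \<open>i\<close> and \<open>j\<close> by an angle depending only on the norm. Conjugating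
  it with a coordinatewise \<open>sinh\<close> of large slope makes the level sets of the norm close to boxes, so
  that the rotation by \<open>pi\<close> can be cut off between two given boxes.\<close>

definition plane_rotation :: "'n \<Rightarrow> 'n \<Rightarrow> (real \<Rightarrow> real) \<Rightarrow> real^'n \<Rightarrow> real^'n::finite" where
  "plane_rotation i j \<theta> y = (let t = \<theta> (\<Sum>l\<in>UNIV. (y $ l)\<^sup>2) in
     \<chi> l. if l = i then cos t * y $ i - sin t * y $ j
         else if l = j then sin t * y $ i + cos t * y $ j else y $ l)"

lemma plane_rotation_norm:
  assumes "i \<noteq> j"
  shows "(\<Sum>l\<in>UNIV. (plane_rotation i j \<theta> y $ l)\<^sup>2) = (\<Sum>l\<in>UNIV. (y $ l)\<^sup>2)"
proof (rule sum_two_changed[OF assms])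
  define t where "t = \<theta> (\<Sum>l\<in>UNIV. (y $ l)\<^sup>2)"
  have "(cos t * a - sin t * b)\<^sup>2 + (sin t * a + cos t * b)\<^sup>2
      = ((sin t)\<^sup>2 + (cos t)\<^sup>2) * (a\<^sup>2 + b\<^sup>2)" for a b :: real
    by algebra
  then have "(cos t * a - sin t * b)\<^sup>2 + (sin t * a + cos t * b)\<^sup>2 = a\<^sup>2 + b\<^sup>2" for a b :: real
    by simp
  then show "(plane_rotation i j \<theta> y $ i)\<^sup>2 + (plane_rotation i j \<theta> y $ j)\<^sup>2 = (y $ i)\<^sup>2 + (y $ j)\<^sup>2"
    using assms by (simp add: plane_rotation_def Let_def t_def)
qed (simp add: plane_rotation_def Let_def)

text \<open>The rotation preserves the norm, on which alone the angle depends, so the opposite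
  rotation meets the same angle at the image point.\<close>

lemma plane_rotation_inverse:
  assumes "i \<noteq> j"
  shows "plane_rotation i j (\<lambda>s. - \<theta> s) (plane_rotation i j \<theta> y) = y"
proof -
  define t where "t = \<theta> (\<Sum>l\<in>UNIV. (y $ l)\<^sup>2)"
  have *: "plane_rotation i j \<theta> y $ l = (if l = i then cos t * y $ i - sin t * y $ j
         else if l = j then sin t * y $ i + cos t * y $ j else y $ l)" for l
    by (simp add: plane_rotation_def Let_def t_def)
  have "cos t * (cos t * a - sin t * b) + sin t * (sin t * a + cos t * b) = a"
       "cos t * (sin t * a + cos t * b) - sin t * (cos t * a - sin t * b) = b" for a b :: real
    using sin_cos_squared_add3[of t] by algebra+
  then show ?thesis
    using assms unfolding plane_rotation_def[of i j "\<lambda>s. - \<theta> s"] plane_rotation_norm[OF assms]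
    by (simp add: * Let_def vec_eq_iff flip: t_def)
qed

lemma Ck_on_plane_rotation:
  assumes "Ck_on k \<theta> UNIV"
  shows "Ck_on k (plane_rotation i j \<theta>) UNIV"
proof -
  let ?t = "\<lambda>y::real^'a. \<theta> (\<Sum>l\<in>UNIV. (y $ l)\<^sup>2)"
  have t: "Ck_on k ?t UNIV"
    unfolding power2_eq_square
    by (intro Ck_on_compose[OF assms] Ck_on_sum Ck_on_mult Ck_on_nth Ck_on_ident)
  have sc: "Ck_on k (\<lambda>y. sin (?t y)) UNIV" "Ck_on k (\<lambda>y. cos (?t y)) UNIV"
    using Ck_on_sin_cos Ck_on_compose[OF _ t] by blast+
  have "Ck_on k (\<lambda>y. if l = i then cos (?t y) * y $ i - sin (?t y) * y $ j
         else if l = j then sin (?t y) * y $ i + cos (?t y) * y $ j else y $ l) UNIV" for l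
  proof -
    consider "l = i" | "l \<noteq> i" "l = j" | "l \<noteq> i" "l \<noteq> j" by blast
    then show ?thesis
      by cases (simp_all add: Ck_on_diff Ck_on_add Ck_on_mult sc Ck_on_nth Ck_on_ident)
  qed
  then show ?thesis
    unfolding plane_rotation_def[abs_def] Let_def by (rule Ck_on_vec_lambda)
qed

lemma box_twist:
  fixes p a a' :: "real^'n::finite"
  assumes ij: "i \<noteq> j" and a: "\<And>l. 0 < a $ l" "\<And>l. a $ l < a' $ l"
  obtains T T' where "\<And>k. Ck_on k T UNIV" "\<And>k. Ck_on k T' UNIV"
    "\<And>x. T' (T x) = x" "\<And>x. T (T' x) = x"
    "\<And>x l. a' $ l \<le> \<bar>x $ l - p $ l\<bar> \<Longrightarrow> T x = x"
    "\<And>x. (\<And>l. \<bar>x $ l - p $ l\<bar> \<le> a $ l) \<Longrightarrow> T x = (\<chi> l. if l = i \<or> l = j then 2 * p $ l - x $ l else x $ l)"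
proof -
  have "\<forall>\<^sub>F M in at_top. \<forall>l. CARD('n) * sinh M ^ 2 < sinh ((a' $ l / a $ l) * M) ^ 2"
    by (intro eventually_all_finite eventually_sinh_power2_less) (use a in auto)
  from eventually_happens[OF eventually_conj[OF eventually_gt_at_top[of 0] this]]
  obtain M :: real where M: "M > 0"
    and M': "\<And>l. CARD('n) * sinh M ^ 2 < sinh ((a' $ l / a $ l) * M) ^ 2"
    by auto
  \<comment> \<open>In the coordinates \<open>S\<close> below, the squared norm is at most \<alpha>
    on the inner box and at least \<beta> off the outer one, so the angle can drop from
    \<open>pi\<close> to 0 in between.\<close>
  define \<alpha> where "\<alpha> = CARD('n) * sinh M ^ 2"
  define \<beta> where "\<beta> = Min (range (\<lambda>l. sinh ((a' $ l / a $ l) * M) ^ 2))"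
  have "\<alpha> < \<beta>"
    using M' by (simp add: \<alpha>_def \<beta>_def)
  from smooth_cutoff[OF this] obtain \<eta> :: "real \<Rightarrow> real" where \<eta>: "\<And>k. Ck_on k \<eta> UNIV" "\<And>t. t \<le> \<alpha> \<Longrightarrow> \<eta> t = 1" "\<And>t. t \<ge> \<beta> \<Longrightarrow> \<eta> t = 0"
    by metis
  define S where "S x = (\<chi> l. sinh (M / a $ l * (x $ l - p $ l)))" for x
  define S' where "S' y = (\<chi> l. p $ l + a $ l / M * arsinh (y $ l))" for y
  have S: "S' (S x) = x" "S (S' y) = y" for x y
  proof -
    have "a $ l \<noteq> 0" for l
      using a(1)[of l] by simp
    then show "S' (S x) = x" "S (S' y) = y"
      using M by (simp_all add: S_def S'_def vec_eq_iff arsinh_sinh_real)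
  qed
  have Ck_S: "Ck_on k S UNIV" for k
    unfolding S_def[abs_def]
    by (intro Ck_on_vec_lambda Ck_on_compose[OF conjunct1[OF Ck_on_sinh_cosh]] Ck_on_cmult
        Ck_on_diff Ck_on_nth Ck_on_ident Ck_on_const)
  have Ck_S': "Ck_on k S' UNIV" for k
    unfolding S'_def[abs_def]
    by (intro Ck_on_vec_lambda Ck_on_add Ck_on_cmult Ck_on_compose[OF Ck_on_arsinh] Ck_on_nth
        Ck_on_ident Ck_on_const)
  define \<theta> where "\<theta> t = pi * \<eta> t" for t
  have Ck_\<theta>: "Ck_on k \<theta> UNIV" "Ck_on k (\<lambda>t. - \<theta> t) UNIV" for k
    unfolding \<theta>_def[abs_def] by (intro Ck_on_minus Ck_on_cmult \<eta>)+
  define R R' where "R = plane_rotation i j \<theta>" and "R' = plane_rotation i j (\<lambda>t. - \<theta> t)"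
  have R: "R' (R y) = y" "R (R' y) = y" for y
    using plane_rotation_inverse[OF ij, of \<theta>] plane_rotation_inverse[OF ij, of "\<lambda>t. - \<theta> t"]
    by (simp_all add: R_def R'_def)
  show thesis
  proof (rule that[of "\<lambda>x. S' (R (S x))" "\<lambda>x. S' (R' (S x))"])
    show "Ck_on k (\<lambda>x. S' (R (S x))) UNIV" "Ck_on k (\<lambda>x. S' (R' (S x))) UNIV" for k
      unfolding R_def R'_def
      using Ck_on_compose[OF Ck_S' Ck_on_compose[OF Ck_on_plane_rotation[OF Ck_\<theta>(1)] Ck_S]]
        Ck_on_compose[OF Ck_S' Ck_on_compose[OF Ck_on_plane_rotation[OF Ck_\<theta>(2)] Ck_S]] by auto
    show "S' (R' (S (S' (R (S x))))) = x" "S' (R (S (S' (R' (S x))))) = x" for x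
      by (simp_all add: S R)
    show "S' (R (S x)) = x" if x: "a' $ l \<le> \<bar>x $ l - p $ l\<bar>" for x l
    proof -
      have "\<beta> \<le> sinh ((a' $ l / a $ l) * M) ^ 2"
        by (simp add: \<beta>_def)
      also have "\<dots> \<le> (sinh \<bar>M / a $ l * (x $ l - p $ l)\<bar>)\<^sup>2"
      proof (rule power_mono)
        have "a' $ l / a $ l * M \<le> \<bar>M / a $ l * (x $ l - p $ l)\<bar>"
          using mult_left_mono[OF x, of "M / a $ l"] M a(1)[of l] by (simp add: abs_mult mult.commute)
        then show "sinh (a' $ l / a $ l * M) \<le> sinh \<bar>M / a $ l * (x $ l - p $ l)\<bar>"
          by simp
        show "0 \<le> sinh (a' $ l / a $ l * M)"
          using a(1)[of l] a(2)[of l] M by simp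
      qed
      also have "\<dots> = (S x $ l)\<^sup>2"
        by (simp only: S_def vec_lambda_beta sinh_real_abs power2_abs)
      also have "\<dots> \<le> (\<Sum>l\<in>UNIV. (S x $ l)\<^sup>2)"
        by (rule member_le_sum) auto
      finally have "\<theta> (\<Sum>l\<in>UNIV. (S x $ l)\<^sup>2) = 0"
        by (simp add: \<theta>_def \<eta>)
      then have "R (S x) = S x"
        by (simp add: R_def plane_rotation_def vec_eq_iff)
      then show ?thesis
        by (simp add: S)
    qed
    show "S' (R (S x)) = (\<chi> l. if l = i \<or> l = j then 2 * p $ l - x $ l else x $ l)"
      if x: "\<And>l. \<bar>x $ l - p $ l\<bar> \<le> a $ l" for x
    proof -
      have "(S x $ l)\<^sup>2 \<le> (sinh M)\<^sup>2" for l
      proof -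
        have "(S x $ l)\<^sup>2 = (sinh \<bar>M / a $ l * (x $ l - p $ l)\<bar>)\<^sup>2"
          by (simp only: S_def vec_lambda_beta sinh_real_abs power2_abs)
        also have "\<dots> \<le> (sinh M)\<^sup>2"
        proof (rule power_mono)
          have "\<bar>M / a $ l * (x $ l - p $ l)\<bar> \<le> M"
            using mult_left_mono[OF x[of l], of "M / a $ l"] M a(1)[of l] by (simp add: abs_mult)
          then show "sinh \<bar>M / a $ l * (x $ l - p $ l)\<bar> \<le> sinh M"
            by simp
        qed simp
        finally show ?thesis .
      qed
      then have "(\<Sum>l\<in>UNIV. (S x $ l)\<^sup>2) \<le> (\<Sum>l\<in>(UNIV::'n set). (sinh M)\<^sup>2)"
        by (rule sum_mono)
      then have "\<theta> (\<Sum>l\<in>UNIV. (S x $ l)\<^sup>2) = pi"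
        by (simp add: \<theta>_def \<eta> \<alpha>_def)
      then have "R (S x) = (\<chi> l. if l = i \<or> l = j then - S x $ l else S x $ l)"
        by (auto simp: R_def plane_rotation_def vec_eq_iff)
      \<comment> \<open>Since \<open>sinh\<close> is odd, the half turn commutes with the change of
        coordinates; the twist is thus exactly rigid on the inner box.\<close>
      also have "\<dots> = S (\<chi> l. if l = i \<or> l = j then 2 * p $ l - x $ l else x $ l)"
      proof -
        have "M / a $ l * (2 * p $ l - x $ l - p $ l) = - (M / a $ l * (x $ l - p $ l))" for l
          by (simp add: algebra_simps)
        then show ?thesis
          by (simp add: S_def vec_eq_iff)
      qed
      finally show ?thesis
        by (simp add: S)
    qed
  qed
qed

text \<open>\<open>a'\<close> holds the half-widths of the supports and \<open>a\<close> those of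
  the boxes that are turned rigidly. Invariance of the outer boxes is recorded because it keeps
  composed twists from interfering.\<close>

definition box_twists ::
    "'n \<Rightarrow> 'n \<Rightarrow> real^'n \<Rightarrow> real^'n \<Rightarrow> (real^'n) set \<Rightarrow> (real^'n \<Rightarrow> real^'n) \<Rightarrow> (real^'n \<Rightarrow> real^'n::finite) \<Rightarrow> bool"
  where "box_twists i j a a' P F F' \<longleftrightarrow>
    (\<forall>k. Ck_on k F UNIV) \<and> (\<forall>k. Ck_on k F' UNIV) \<and>
    (\<forall>x. F' (F x) = x) \<and> (\<forall>x. F (F' x) = x) \<and>
    (\<forall>x. (\<forall>p\<in>P. \<exists>l. a' $ l \<le> \<bar>x $ l - p $ l\<bar>) \<longrightarrow> F x = x) \<and>
    (\<forall>p\<in>P. \<forall>x. (\<forall>l. \<bar>x $ l - p $ l\<bar> < a' $ l) \<longrightarrow> (\<forall>l. \<bar>F x $ l - p $ l\<bar> < a' $ l)) \<and>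
    (\<forall>p\<in>P. \<forall>x. (\<forall>l. \<bar>x $ l - p $ l\<bar> \<le> a $ l) \<longrightarrow>
       F x = (\<chi> l. if l = i \<or> l = j then 2 * p $ l - x $ l else x $ l))"

lemma box_twistsD:
  assumes "box_twists i j a a' P F F'"
  shows "Ck_on k F UNIV" "Ck_on k F' UNIV" "F' (F x) = x" "F (F' x) = x"
    "\<forall>p\<in>P. \<exists>l. a' $ l \<le> \<bar>x $ l - p $ l\<bar> \<Longrightarrow> F x = x"
    "p \<in> P \<Longrightarrow> \<forall>l. \<bar>x $ l - p $ l\<bar> < a' $ l \<Longrightarrow> \<forall>l. \<bar>F x $ l - p $ l\<bar> < a' $ l"
    "p \<in> P \<Longrightarrow> \<forall>l. \<bar>x $ l - p $ l\<bar> \<le> a $ l \<Longrightarrow>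
       F x = (\<chi> l. if l = i \<or> l = j then 2 * p $ l - x $ l else x $ l)"
  using assms unfolding box_twists_def by blast+

text \<open>The twists about the single centres are composed. The separation of the centres makes
  the open outer boxes disjoint, so each factor is the identity on the boxes of the others.\<close>

lemma box_twists_exist:
  fixes a a' :: "real^'n::finite"
  assumes ij: "i \<noteq> j" and a: "\<And>l. 0 < a $ l" "\<And>l. a $ l < a' $ l" and "finite P"
    and disj: "\<And>p q. p \<in> P \<Longrightarrow> q \<in> P \<Longrightarrow> p \<noteq> q \<Longrightarrow> \<exists>l. 2 * a' $ l \<le> \<bar>p $ l - q $ l\<bar>"
  shows "\<exists>F F'. box_twists i j a a' P F F'"
  using \<open>finite P\<close> disj
proof (induction P rule: finite_induct)
  case empty
  show ?case
    by (intro exI[of _ "\<lambda>x. x"]) (simp add: Ck_on_ident box_twists_def)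
next
  case (insert p P)
  then obtain F F' where FF: "box_twists i j a a' P F F'"
    by blast
  note F = box_twistsD[OF FF]
  obtain T T' where T: "\<And>k. Ck_on k T UNIV" "\<And>k. Ck_on k T' UNIV"
    "\<And>x. T' (T x) = x" "\<And>x. T (T' x) = x"
    "\<And>x l. a' $ l \<le> \<bar>x $ l - p $ l\<bar> \<Longrightarrow> T x = x"
    "\<And>x. (\<And>l. \<bar>x $ l - p $ l\<bar> \<le> a $ l) \<Longrightarrow> T x = (\<chi> l. if l = i \<or> l = j then 2 * p $ l - x $ l else x $ l)"
    using box_twist[OF ij a, of p] by blast
  have far: "\<exists>l. a' $ l \<le> \<bar>x $ l - q $ l\<bar>"
    if "q \<in> insert p P" "r \<in> insert p P" "q \<noteq> r" and x: "\<forall>l. \<bar>x $ l - r $ l\<bar> < a' $ l" for q r x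
  proof -
    obtain l where "2 * a' $ l \<le> \<bar>q $ l - r $ l\<bar>"
      using insert.prems \<open>q \<in> insert p P\<close> \<open>r \<in> insert p P\<close> \<open>q \<noteq> r\<close> by blast
    moreover have "\<bar>x $ l - r $ l\<bar> < a' $ l"
      using x by blast
    ultimately have "a' $ l \<le> \<bar>x $ l - q $ l\<bar>"
      by linarith
    then show ?thesis by blast
  qed
  \<comment> \<open>\<open>T\<close> is injective and fixes every point outside the box, so no inner
    point can leave it.\<close>
  have T_box: "\<forall>l. \<bar>T x $ l - p $ l\<bar> < a' $ l" if x: "\<forall>l. \<bar>x $ l - p $ l\<bar> < a' $ l" for x
  proof (rule ccontr)
    assume "\<not> ?thesis"
    then obtain l where "a' $ l \<le> \<bar>T x $ l - p $ l\<bar>" by (auto simp: not_less)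
    then have "T (T x) = T x" by (rule T(5))
    then have "T x = x" by (metis T(3))
    with \<open>\<not> ?thesis\<close> x show False by simp
  qed
  have F_p: "F x = x" if "\<forall>l. \<bar>x $ l - p $ l\<bar> < a' $ l" for x
    using F(5)[of x] far[of _ p x] that insert.hyps by blast
  have T_q: "T x = x" if "q \<in> P" "\<forall>l. \<bar>x $ l - q $ l\<bar> < a' $ l" for q x
    using T(5) far[of p q x] that insert.hyps by blast
  have inner: "\<forall>l. \<bar>x $ l - q $ l\<bar> < a' $ l" if "\<forall>l. \<bar>x $ l - q $ l\<bar> \<le> a $ l" for q x
    using that a(2) by (meson le_less_trans)
  have "box_twists i j a a' (insert p P) (\<lambda>x. T (F x)) (\<lambda>x. F' (T' x))"
    unfolding box_twists_def
  proof (intro conjI allI ballI impI)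
    fix q x assume q: "q \<in> insert p P" and x: "\<forall>l. \<bar>x $ l - q $ l\<bar> < a' $ l"
    show "\<bar>T (F x) $ l - q $ l\<bar> < a' $ l" for l
      using q x T_box F_p F(6) T_q by (cases "q = p") auto
  next
    fix q x assume q: "q \<in> insert p P" and x: "\<forall>l. \<bar>x $ l - q $ l\<bar> \<le> a $ l"
    show "T (F x) = (\<chi> l. if l = i \<or> l = j then 2 * q $ l - x $ l else x $ l)"
    proof (cases "q = p")
      case True
      then show ?thesis
        using F_p inner[OF x] T(6) x unfolding True by simp
    next
      case False
      then have "q \<in> P" using q by simp
      then have "T (F x) = F x"
        using T_q F(6) inner[OF x] by blast
      then show ?thesis
        using F(7) \<open>q \<in> P\<close> x by simp
    qed
  next
    fix x assume "\<forall>q\<in>insert p P. \<exists>l. a' $ l \<le> \<bar>x $ l - q $ l\<bar>"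
    then show "T (F x) = x"
      using F(5)[of x] T(5)[of _ x] by auto
  next
    show "Ck_on k (\<lambda>x. T (F x)) UNIV" "Ck_on k (\<lambda>x. F' (T' x)) UNIV" for k
      by (rule Ck_on_compose[OF T(1) F(1)] Ck_on_compose[OF F(2) T(2)])+
  qed (simp_all add: F(3,4) T(3,4))
  then show ?case by blast
qed

section \<open>The Cantor set\<close>

text \<open>\<open>radius k\<close> is half the side length of the \<open>2 ^ (k * n)\<close> cubes of level \<open>k\<close>. It is chosen such
  that \<open>2 ^ k * (2 * radius k)\<close> decreases to \<open>1/2\<close>.\<close>

definition radius :: "nat \<Rightarrow> real" where
  "radius k = (1/2) ^ (k + 2) + (1/2) ^ (2 * k + 3)"

primrec cantor_centers :: "nat \<Rightarrow> real set" where
  "cantor_centers 0 = {1/2}"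
| "cantor_centers (Suc k) =
    (\<lambda>d. d - radius k / 2) ` cantor_centers k \<union> (\<lambda>d. d + radius k / 2) ` cantor_centers k"

definition cube :: "real^'n \<Rightarrow> real \<Rightarrow> (real^'n::finite) set" where
  "cube c r = {x. \<forall>l. \<bar>x $ l - c $ l\<bar> \<le> r}"

definition centers :: "nat \<Rightarrow> (real^'n::finite) set" where
  "centers k = {c. \<forall>l. c $ l \<in> cantor_centers k}"

definition level :: "nat \<Rightarrow> (real^'n::finite) set" where
  "level k = (\<Union>c\<in>centers k. cube c (radius k))"

definition cantor_cube :: "(real^'n::finite) set" where
  "cantor_cube = (\<Inter>k. level k)"

lemma radius_pos: "radius k > 0"
  by (simp add: radius_def add_pos_pos)

text \<open>Strictness is the gap between the two children of an interval; it makes the inner boxes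
  strictly smaller than the outer ones.\<close>

lemma radius_Suc: "2 * radius (Suc k) < radius k"
  by (simp add: radius_def power_add power3_eq_cube eval_nat_numeral)

lemma radius_0: "radius 0 = 3/8"
  by (simp add: radius_def power3_eq_cube power2_eq_square)

lemma radius_tendsto_0: "radius \<longlonglongrightarrow> 0"
proof -
  have "(\<lambda>k. (1/2) ^ k * (1/4) + (1/4) ^ k * (1/8)) \<longlonglongrightarrow> (0 * (1/4) + 0 * (1/8) :: real)"
    by (intro tendsto_intros LIMSEQ_realpow_zero) auto
  moreover have "radius k = (1/2) ^ k * (1/4) + (1/4) ^ k * (1/8)" for k
    by (simp add: radius_def power_add power_mult power2_eq_square power3_eq_cube)
  then have "radius = (\<lambda>k. (1/2) ^ k * (1/4) + (1/4) ^ k * (1/8))" by blast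
  ultimately show ?thesis by simp
qed

lemma finite_cantor_centers: "finite (cantor_centers k)"
  by (induction k) auto

lemma cantor_centers_parent:
  assumes "d \<in> cantor_centers (Suc k)"
  obtains d' where "d' \<in> cantor_centers k" "\<bar>d - d'\<bar> = radius k / 2"
  using assms radius_pos[of k] by fastforce

text \<open>Siblings are \<open>radius k\<close> apart, and children of distinct centres lose at
  most \<open>radius k\<close> of more than \<open>2 * radius k\<close>. The second bound is the
  sharper one and is what admits twists of half-width \<open>radius k / 2\<close> along
  \<open>turn_axis\<close>.\<close>

lemma cantor_centers_separated:
  "d \<in> cantor_centers k \<Longrightarrow> d' \<in> cantor_centers k \<Longrightarrow> d \<noteq> d' \<Longrightarrow> 2 * radius k < \<bar>d - d'\<bar>"
  "d \<in> cantor_centers (Suc k) \<Longrightarrow> d' \<in> cantor_centers (Suc k) \<Longrightarrow> d \<noteq> d' \<Longrightarrow> radius k \<le> \<bar>d - d'\<bar>"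
proof -
  have step: "radius k \<le> \<bar>d - d'\<bar>"
    if IH: "\<And>d d'. d \<in> cantor_centers k \<Longrightarrow> d' \<in> cantor_centers k \<Longrightarrow> d \<noteq> d' \<Longrightarrow> 2 * radius k < \<bar>d - d'\<bar>"
      and d: "d \<in> cantor_centers (Suc k)" "d' \<in> cantor_centers (Suc k)" "d \<noteq> d'" for k d d'
  proof -
    from d(1) obtain e s where e: "e \<in> cantor_centers k" "d = e + s" "s = radius k / 2 \<or> s = - radius k / 2"
      by fastforce
    from d(2) obtain e' s' where e': "e' \<in> cantor_centers k" "d' = e' + s'" "s' = radius k / 2 \<or> s' = - radius k / 2"
      by fastforce
    show ?thesis
    proof (cases "e = e'")
      case True
      then show ?thesis using e e' d(3) by auto
    next
      case False
      then show ?thesis using IH[OF e(1) e'(1)] e e' by (auto simp: abs_if split: if_splits)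
    qed
  qed
  show *: "2 * radius k < \<bar>d - d'\<bar>"
    if "d \<in> cantor_centers k" "d' \<in> cantor_centers k" "d \<noteq> d'" for d d' k
    using that
  proof (induction k arbitrary: d d')
    case (Suc k)
    then have "radius k \<le> \<bar>d - d'\<bar>"
      by (intro step) auto
    then show ?case
      using radius_Suc[of k] by simp
  qed simp
  show "d \<in> cantor_centers (Suc k) \<Longrightarrow> d' \<in> cantor_centers (Suc k) \<Longrightarrow> d \<noteq> d' \<Longrightarrow> radius k \<le> \<bar>d - d'\<bar>"
    using step * by blast
qed

lemma card_cantor_centers: "card (cantor_centers k) = 2 ^ k"
proof (induction k)
  case (Suc k)
  have "(\<lambda>d. d - radius k / 2) ` cantor_centers k \<inter> (\<lambda>d. d + radius k / 2) ` cantor_centers k = {}"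
  proof (safe)
    fix d d' assume d: "d \<in> cantor_centers k" "d' \<in> cantor_centers k"
      and eq: "d - radius k / 2 = d' + radius k / 2"
    then have "d \<noteq> d'" using radius_pos[of k] by auto
    from cantor_centers_separated(1)[OF d this] eq radius_pos[of k] show "d - radius k / 2 \<in> {}"
      by simp
  qed
  then show ?case
    using Suc finite_cantor_centers[of k]
    by (simp add: card_Un_disjoint card_image inj_on_def)
qed simp

lemma cantor_centers_symmetric: "d \<in> cantor_centers k \<Longrightarrow> 1 - d \<in> cantor_centers k"
proof (induction k arbitrary: d)
  case (Suc k)
  then obtain e where e: "e \<in> cantor_centers k" "d = e - radius k / 2 \<or> d = e + radius k / 2"
    by auto
  then have "1 - d = (1 - e) - radius k / 2 \<or> 1 - d = (1 - e) + radius k / 2"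
    by auto
  then show ?case
    using Suc.IH[OF e(1)] unfolding cantor_centers.simps(2) by blast
qed simp

lemma cantor_centers_nested:
  assumes "m \<le> k" "d \<in> cantor_centers k"
  shows "\<exists>d'\<in>cantor_centers m. \<bar>d - d'\<bar> + radius k \<le> radius m"
  using assms
proof (induction k arbitrary: d rule: dec_induct)
  case base
  then show ?case by force
next
  case (step k)
  obtain e where e: "e \<in> cantor_centers k" "\<bar>d - e\<bar> = radius k / 2"
    using cantor_centers_parent[OF step.prems] by blast
  obtain d' where "d' \<in> cantor_centers m" "\<bar>e - d'\<bar> + radius k \<le> radius m"
    using step.IH[OF e(1)] by blast
  then show ?case
    using e radius_Suc[of k] by (intro bexI[of _ d']) linarith+
qed

lemma centers_parent:
  assumes "c \<in> centers (Suc k)"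
  obtains c' where "c' \<in> centers k" "\<And>l. \<bar>c $ l - c' $ l\<bar> = radius k / 2"
proof -
  have "\<exists>d. d \<in> cantor_centers k \<and> \<bar>c $ l - d\<bar> = radius k / 2" for l
    using assms cantor_centers_parent[of "c $ l" k] by (auto simp: centers_def)
  then obtain d where "\<And>l. d l \<in> cantor_centers k \<and> \<bar>c $ l - d l\<bar> = radius k / 2"
    by metis
  then show thesis
    by (intro that[of "\<chi> l. d l"]) (auto simp: centers_def)
qed

lemma centers_nested:
  assumes "m \<le> k" "c \<in> centers k"
  obtains c' where "c' \<in> centers m" "cube c (radius k) \<subseteq> cube c' (radius m)"
proof -
  have "\<exists>d. d \<in> cantor_centers m \<and> \<bar>c $ l - d\<bar> + radius k \<le> radius m" for l
    using assms cantor_centers_nested[of m k "c $ l"] by (auto simp: centers_def)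
  then obtain d where d: "\<And>l. d l \<in> cantor_centers m \<and> \<bar>c $ l - d l\<bar> + radius k \<le> radius m"
    by metis
  show thesis
  proof (rule that[of "\<chi> l. d l"])
    show "(\<chi> l. d l) \<in> centers m"
      using d by (auto simp: centers_def)
    have "\<bar>x $ l - d l\<bar> \<le> radius m" if "\<bar>x $ l - c $ l\<bar> \<le> radius k" for x :: "real^'a" and l
      using d[of l] that by linarith
    then show "cube c (radius k) \<subseteq> cube (\<chi> l. d l) (radius m)"
      by (auto simp: cube_def)
  qed
qed

lemma centers_unique:
  assumes "c \<in> centers k" "c' \<in> centers k" "x \<in> cube c (radius k)" "x \<in> cube c' (radius k)"
  shows "c = c'"
proof (rule ccontr)
  assume "c \<noteq> c'"
  then obtain l where l: "c $ l \<noteq> c' $ l"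
    by (auto simp: vec_eq_iff)
  have "2 * radius k < \<bar>c $ l - c' $ l\<bar>"
    using cantor_centers_separated(1)[of "c $ l" k "c' $ l"] assms l by (auto simp: centers_def)
  moreover have "\<bar>x $ l - c $ l\<bar> \<le> radius k" "\<bar>x $ l - c' $ l\<bar> \<le> radius k"
    using assms by (auto simp: cube_def)
  ultimately show False by linarith
qed

lemma level_antimono:
  assumes "m \<le> k"
  shows "level k \<subseteq> level m"
proof
  fix x :: "real^'a" assume "x \<in> level k"
  then obtain c where c: "c \<in> centers k" "x \<in> cube c (radius k)"
    by (auto simp: level_def)
  obtain c' where "c' \<in> centers m" "cube c (radius k) \<subseteq> cube c' (radius m)"
    using centers_nested[OF assms c(1)] .
  then show "x \<in> level m"
    using c by (auto simp: level_def)
qed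

section \<open>Counting, compactness and measure of the levels\<close>

lemma vec_lambda_PiE:
  "{c :: 'a^'n::finite. \<forall>l. c $ l \<in> D l} = vec_lambda ` (\<Pi>\<^sub>E l\<in>UNIV. D l)" (is "?A = ?B")
proof
  show "?A \<subseteq> ?B"
  proof
    fix c assume "c \<in> ?A"
    then have "c = vec_lambda (($) c)" "($) c \<in> (\<Pi>\<^sub>E l\<in>UNIV. D l)" by auto
    then show "c \<in> ?B" by blast
  qed
qed auto

lemma finite_vec_Collect: "(\<And>l. finite (D l)) \<Longrightarrow> finite {c :: 'a^'n::finite. \<forall>l. c $ l \<in> D l}"
  unfolding vec_lambda_PiE by (intro finite_imageI finite_PiE) auto

lemma card_vec_Collect:
  "card {c :: 'a^'n::finite. \<forall>l. c $ l \<in> D l} = (\<Prod>l\<in>UNIV. card (D l))"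
  unfolding vec_lambda_PiE by (subst card_image) (auto simp: card_PiE vec_lambda_inject intro: inj_onI)

lemma finite_centers: "finite (centers k)"
  unfolding centers_def by (intro finite_vec_Collect finite_cantor_centers)

lemma card_centers: "card (centers k :: (real^'n::finite) set) = (2 ^ k) ^ CARD('n)"
  unfolding centers_def by (simp add: card_vec_Collect card_cantor_centers)

lemma cube_eq_cbox: "cube c r = cbox (\<chi> l. c $ l - r) (\<chi> l. c $ l + r)"
  by (auto simp: cube_def mem_box_cart abs_le_iff algebra_simps)

lemma measure_cube:
  fixes c :: "real^'n::finite"
  assumes "r \<ge> 0"
  shows "measure lebesgue (cube c r) = (2 * r) ^ CARD('n)"
proof -
  have "cbox (\<chi> l. c $ l - r) (\<chi> l. c $ l + r) \<noteq> {}"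
    using assms by (auto simp: interval_ne_empty_cart)
  then show ?thesis
    unfolding cube_eq_cbox by (simp add: content_cbox_cart measure_completion)
qed

lemma compact_level: "compact (level k)"
  unfolding level_def cube_eq_cbox by (intro compact_UN finite_centers compact_cbox)

lemma compact_cantor_cube: "compact cantor_cube"
  unfolding cantor_cube_def by (intro compact_Inter) (auto simp: compact_level)

lemma measure_level:
  "measure lebesgue (level k :: (real^'n::finite) set) = (1/2 + (1/2) ^ (k + 2)) ^ CARD('n)"
proof -
  have "measure lebesgue (level k :: (real^'n) set) = (\<Sum>c\<in>(centers k :: (real^'n) set). measure lebesgue (cube c (radius k)))"
    unfolding level_def
  proof (rule measure_UNION')
    show "pairwise (\<lambda>c c'. disjnt (cube c (radius k)) (cube c' (radius k))) (centers k :: (real^'n) set)"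
      unfolding pairwise_def disjnt_def using centers_unique by blast
  qed (auto simp: finite_centers cube_eq_cbox)
  also have "\<dots> = (2 ^ k) ^ CARD('n) * (2 * radius k) ^ CARD('n)"
    using radius_pos[of k] by (simp add: measure_cube card_centers)
  also have "\<dots> = (2 ^ k * (2 * radius k)) ^ CARD('n)"
    by (simp only: power_mult_distrib)
  \<comment> \<open>This is the total length of the intervals of level \<open>k\<close> on one
    axis.\<close>
  also have "2 ^ k * (2 * radius k) = 1/2 + (1/2) ^ (k + 2)"
  proof -
    have "radius k = (1/2) ^ k * (1/4 + (1/2) ^ k * (1/8))"
      unfolding radius_def mult_2 power_add by (simp add: power3_eq_cube distrib_left power2_eq_square)
    moreover have "2 ^ k * (1/2) ^ k = (1::real)"
      by (simp flip: power_mult_distrib)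
    moreover have "2 ^ k * (2 * ((1/2) ^ k * z)) = 2 * (2 ^ k * (1/2) ^ k) * z" for z :: real
      by (simp only: mult_ac)
    ultimately show ?thesis
      by (simp only: power_add) (simp add: power2_eq_square)
  qed
  finally show ?thesis .
qed

lemma measure_cantor_cube: "measure lebesgue (cantor_cube :: (real^'n::finite) set) = (1/2) ^ CARD('n)"
proof -
  have meas: "(level k :: (real^'n) set) \<in> lmeasurable" for k
    by (intro lmeasurable_compact compact_level)
  have "(\<lambda>k. measure lebesgue (level k :: (real^'n) set)) \<longlonglongrightarrow> measure lebesgue (\<Inter>k. level k :: (real^'n) set)"
    using meas fmeasurableD2[OF meas] by (intro Lim_measure_decseq) (auto simp: decseq_def level_antimono)
  moreover have "(\<lambda>k. measure lebesgue (level k :: (real^'n) set)) \<longlonglongrightarrow> (1/2 + 0) ^ CARD('n)"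
    unfolding measure_level
    by (intro tendsto_intros LIMSEQ_ignore_initial_segment[OF LIMSEQ_realpow_zero]) auto
  ultimately show ?thesis
    unfolding cantor_cube_def using LIMSEQ_unique by fastforce
qed

section \<open>Symmetry under the reflection and position in the unit cube\<close>

lemma reflection_nth: "reflection x $ l = (if l = last_index then 1 - x $ l else x $ l)"
  by (simp add: reflection_def)

lemma reflection_involution: "reflection (reflection x) = x"
  by (simp add: reflection_nth vec_eq_iff)

lemma reflection_centers: "c \<in> centers k \<Longrightarrow> reflection c \<in> centers k"
  by (simp add: centers_def reflection_nth cantor_centers_symmetric)

lemma reflection_cube: "x \<in> cube c r \<Longrightarrow> reflection x \<in> cube (reflection c) r"
  by (simp add: cube_def reflection_nth abs_minus_commute)

lemma reflection_level: "x \<in> level k \<Longrightarrow> reflection x \<in> level k"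
  unfolding level_def using reflection_centers reflection_cube by blast

lemma reflection_cantor_cube: "reflection x \<in> cantor_cube \<longleftrightarrow> x \<in> cantor_cube"
  using reflection_level[of x] reflection_level[of "reflection x"]
  by (auto simp: cantor_cube_def reflection_involution)

lemma level_0_subset: "level 0 \<subseteq> interior unit_cube"
proof -
  have "{x. \<forall>l. 0 < x $ l \<and> x $ l < 1} = box 0 (1 :: real^'n)"
    by (simp add: set_eq_iff mem_box_cart)
  then have "{x :: real^'n. \<forall>l. 0 < x $ l \<and> x $ l < 1} \<subseteq> interior unit_cube"
    by (intro interior_maximal) (auto simp: unit_cube_def intro: less_imp_le)
  moreover have "level 0 \<subseteq> {x :: real^'n. \<forall>l. 0 < x $ l \<and> x $ l < 1}"
  proof
    fix x :: "real^'n" assume "x \<in> level 0"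
    then obtain c where c: "c \<in> centers 0" "x \<in> cube c (radius 0)"
      by (auto simp: level_def)
    have bound: "\<bar>x $ l - 1/2\<bar> \<le> 3/8" for l
    proof -
      have "c $ l = 1/2"
        using c(1) by (simp add: centers_def)
      moreover have "\<bar>x $ l - c $ l\<bar> \<le> 3/8"
        using c(2) unfolding cube_def radius_0 by blast
      ultimately show ?thesis by metis
    qed
    have "0 < x $ l \<and> x $ l < 1" for l
      using bound[of l] by linarith
    then show "x \<in> {x. \<forall>l. 0 < x $ l \<and> x $ l < 1}" by blast
  qed
  ultimately show ?thesis by blast
qed

section \<open>The limit of the twists\<close>

text \<open>At level \<open>k\<close> every cube is cut into the halves of its \<open>turn_axis\<close> direction, and each half is
  rotated by \<open>pi\<close> about its centre in the plane of the two axes. This exchanges subcubes along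
  \<open>flip_axis\<close> and turns each of them by \<open>pi\<close>; because of the turned coordinates, the next level has to
  interchange the roles of the axes in order to reflect along \<open>last_index\<close> again.\<close>

definition turn_axis :: "'n::{finite,linorder} \<Rightarrow> nat \<Rightarrow> 'n" where
  "turn_axis i0 k = (if even k then i0 else last_index)"

definition flip_axis :: "'n::{finite,linorder} \<Rightarrow> nat \<Rightarrow> 'n" where
  "flip_axis i0 k = (if even k then last_index else i0)"

text \<open>The outer box is half of a cube of level \<open>k\<close>, cut across
  \<open>turn_axis\<close>; the inner box is the hull of the cubes of level \<open>k + 1\<close> in
  that half.\<close>

definition inner_box :: "'n::{finite,linorder} \<Rightarrow> nat \<Rightarrow> (real, 'n) vec" where
  "inner_box i0 k = (\<chi> l. if l = turn_axis i0 k then radius (Suc k) else radius k / 2 + radius (Suc k))"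

definition outer_box :: "'n::{finite,linorder} \<Rightarrow> nat \<Rightarrow> (real, 'n) vec" where
  "outer_box i0 k = (\<chi> l. if l = turn_axis i0 k then radius k / 2 else radius k)"

definition twist_centers :: "'n::{finite,linorder} \<Rightarrow> nat \<Rightarrow> (real, 'n) vec set" where
  "twist_centers i0 k =
     {p. \<forall>l. p $ l \<in> (if l = turn_axis i0 k then cantor_centers (Suc k) else cantor_centers k)}"

lemma twist_centersD:
  "p \<in> twist_centers i0 k \<Longrightarrow>
    p $ l \<in> (if l = turn_axis i0 k then cantor_centers (Suc k) else cantor_centers k)"
  unfolding twist_centers_def by blast

locale cantor_twists =
  fixes i0 :: "'n::{finite,linorder}" and F F' :: "nat \<Rightarrow> (real, 'n) vec \<Rightarrow> (real, 'n) vec"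
  assumes i0: "i0 \<noteq> last_index"
    and twists: "box_twists (turn_axis i0 k) (flip_axis i0 k) (inner_box i0 k) (outer_box i0 k)
      (twist_centers i0 k) (F k) (F' k)"

lemma cantor_twists_exist:
  fixes i0 :: "'n::{finite,linorder}"
  assumes "i0 \<noteq> last_index"
  shows "\<exists>F F'. cantor_twists i0 F F'"
proof -
  have "\<exists>F F'. box_twists (turn_axis i0 k) (flip_axis i0 k) (inner_box i0 k) (outer_box i0 k)
      (twist_centers i0 k) F F'" for k
  proof (rule box_twists_exist)
    show "turn_axis i0 k \<noteq> flip_axis i0 k"
      using assms by (auto simp: turn_axis_def flip_axis_def)
    show "0 < inner_box i0 k $ l" "inner_box i0 k $ l < outer_box i0 k $ l" for l
      using radius_pos[of k] radius_pos[of "Suc k"] radius_Suc[of k]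
      by (auto simp: inner_box_def outer_box_def)
    show "finite (twist_centers i0 k)"
      unfolding twist_centers_def by (rule finite_vec_Collect) (metis finite_cantor_centers)
    show "\<exists>l. 2 * outer_box i0 k $ l \<le> \<bar>p $ l - q $ l\<bar>"
      if p: "p \<in> twist_centers i0 k" and q: "q \<in> twist_centers i0 k" and "p \<noteq> q" for p q
    proof -
      obtain l where l: "p $ l \<noteq> q $ l"
        using \<open>p \<noteq> q\<close> by (auto simp: vec_eq_iff)
      show ?thesis
      proof (cases "l = turn_axis i0 k")
        \<comment> \<open>The two halves of one cube touch: their centres are
          \<open>radius k\<close> apart, exactly twice the half-width, so the separation cannot be
          strict here.\<close>
        case True
        have "p $ l \<in> cantor_centers (Suc k)" "q $ l \<in> cantor_centers (Suc k)"
          using twist_centersD[OF p, of l] twist_centersD[OF q, of l] True by simp_all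
        from cantor_centers_separated(2)[OF this l] True show ?thesis
          by (intro exI[of _ l]) (simp add: outer_box_def)
      next
        case False
        have "p $ l \<in> cantor_centers k" "q $ l \<in> cantor_centers k"
          using twist_centersD[OF p, of l] twist_centersD[OF q, of l] False by simp_all
        from cantor_centers_separated(1)[OF this l] False show ?thesis
          by (intro exI[of _ l]) (simp add: outer_box_def)
      qed
    qed
  qed
  then obtain F F' where "\<And>k. box_twists (turn_axis i0 k) (flip_axis i0 k) (inner_box i0 k)
      (outer_box i0 k) (twist_centers i0 k) (F k) (F' k)"
    by metis
  then show ?thesis
    using assms cantor_twists.intro by blast
qed

context cantor_twists
begin

lemma outer_box_in_cube:
  assumes "p \<in> twist_centers i0 k"
  obtains c where "c \<in> centers k"
    "\<And>x. \<forall>l. \<bar>x $ l - p $ l\<bar> < outer_box i0 k $ l \<Longrightarrow> x \<in> cube c (radius k)"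
proof -
  let ?i = "turn_axis i0 k"
  note pk = twist_centersD[OF assms]
  have "p $ ?i \<in> cantor_centers (Suc k)"
    using pk[of ?i] by simp
  then obtain d where d: "d \<in> cantor_centers k" "\<bar>p $ ?i - d\<bar> = radius k / 2"
    by (rule cantor_centers_parent)
  let ?c = "\<chi> l. if l = ?i then d else p $ l"
  show thesis
  proof (rule that[of ?c])
    have "?c $ l \<in> cantor_centers k" for l
      using d pk[of l] by (cases "l = ?i") simp_all
    then show "?c \<in> centers k"
      unfolding centers_def by blast
    fix x :: "(real, 'n) vec" assume x: "\<forall>l. \<bar>x $ l - p $ l\<bar> < outer_box i0 k $ l"
    have "\<bar>x $ l - ?c $ l\<bar> \<le> radius k" for l
    proof (cases "l = ?i")
      case True
      have "\<bar>x $ l - p $ l\<bar> < radius k / 2"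
        using spec[OF x, of l] True by (simp add: outer_box_def)
      then show ?thesis
        using d True by (simp add: abs_le_iff abs_less_iff abs_if split: if_splits)
    next
      case False
      then have "\<bar>x $ l - p $ l\<bar> < radius k"
        using spec[OF x, of l] by (simp add: outer_box_def)
      then show ?thesis using False by simp
    qed
    then show "x \<in> cube ?c (radius k)"
      unfolding cube_def by blast
  qed
qed

lemma F_outside:
  assumes "x \<notin> level k"
  shows "F k x = x"
proof (rule box_twistsD(5)[OF twists], rule ccontr)
  assume "\<not> (\<forall>p\<in>twist_centers i0 k. \<exists>l. outer_box i0 k $ l \<le> \<bar>x $ l - p $ l\<bar>)"
  then obtain p where "p \<in> twist_centers i0 k" "\<forall>l. \<bar>x $ l - p $ l\<bar> < outer_box i0 k $ l"
    by (auto simp: not_le)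
  then show False
    using assms unfolding level_def by (metis UN_I outer_box_in_cube)
qed

text \<open>\<open>F k\<close> moves a point only within an outer box. That box lies in a cube of
  level \<open>k\<close>, hence in one of level \<open>m\<close>, which disjointness identifies as
  the given cube.\<close>

lemma F_cube:
  assumes "m \<le> k" "c \<in> centers m" "x \<in> cube c (radius m)"
  shows "F k x \<in> cube c (radius m)"
proof (cases "\<exists>p\<in>twist_centers i0 k. \<forall>l. \<bar>x $ l - p $ l\<bar> < outer_box i0 k $ l")
  case True
  then obtain p where p: "p \<in> twist_centers i0 k" "\<forall>l. \<bar>x $ l - p $ l\<bar> < outer_box i0 k $ l"
    by blast
  obtain c' where c': "c' \<in> centers k"
    "\<And>x. \<forall>l. \<bar>x $ l - p $ l\<bar> < outer_box i0 k $ l \<Longrightarrow> x \<in> cube c' (radius k)"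
    using outer_box_in_cube[OF p(1)] by blast
  obtain c'' where c'': "c'' \<in> centers m" "cube c' (radius k) \<subseteq> cube c'' (radius m)"
    using centers_nested[OF assms(1) c'(1)] .
  have "c'' = c"
    using centers_unique[OF c''(1) assms(2) _ assms(3)] c'(2)[OF p(2)] c''(2) by blast
  then show ?thesis
    using c'(2)[OF box_twistsD(6)[OF twists p]] c''(2) by blast
next
  case False
  then have "F k x = x"
    by (intro box_twistsD(5)[OF twists]) (auto simp: not_less)
  then show ?thesis
    using assms by simp
qed

text \<open>The half turn is about the centre of a half cube, which takes its
  \<open>turn_axis\<close> coordinate from the child and the others from the parent. So the child is
  reversed in place along \<open>turn_axis\<close> and exchanged with its sibling along
  \<open>flip_axis\<close>.\<close>

lemma F_child:
  assumes c': "c' \<in> centers (Suc k)" and c: "c \<in> centers k"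
    and parent: "\<And>l. \<bar>c' $ l - c $ l\<bar> = radius k / 2" and x: "x \<in> cube c' (radius (Suc k))"
  shows "F k x = (\<chi> l. if l = turn_axis i0 k then 2 * c' $ l - x $ l
    else if l = flip_axis i0 k then 2 * c $ l - x $ l else x $ l)"
proof -
  let ?p = "\<chi> l. if l = turn_axis i0 k then c' $ l else c $ l"
  have "?p \<in> twist_centers i0 k"
    using c c' by (auto simp: twist_centers_def centers_def simp del: cantor_centers.simps)
  moreover have "\<bar>x $ l - ?p $ l\<bar> \<le> inner_box i0 k $ l" for l
  proof -
    have "\<bar>x $ l - c' $ l\<bar> \<le> radius (Suc k)"
      using x by (auto simp: cube_def)
    moreover from this have "\<bar>x $ l - c $ l\<bar> \<le> radius k / 2 + radius (Suc k)"
      using parent[of l] by linarith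
    ultimately show ?thesis
      by (cases "l = turn_axis i0 k") (simp_all add: inner_box_def)
  qed
  ultimately show ?thesis
    using box_twistsD(7)[OF twists, of ?p k x] by (simp add: vec_eq_iff)
qed

text \<open>The new factor is applied first. Hence \<open>F k\<close> always acts on the original
  cubes of level \<open>k\<close>, and a point that \<open>F k\<close> fixes has the same image
  under \<open>Phi (Suc k)\<close> as under \<open>Phi k\<close>.\<close>

primrec Phi :: "nat \<Rightarrow> (real, 'n) vec \<Rightarrow> (real, 'n) vec" where
  "Phi 0 = (\<lambda>x. x)"
| "Phi (Suc k) = (\<lambda>x. Phi k (F k x))"

primrec Phi_inv :: "nat \<Rightarrow> (real, 'n) vec \<Rightarrow> (real, 'n) vec" where
  "Phi_inv 0 = (\<lambda>x. x)"
| "Phi_inv (Suc k) = (\<lambda>x. F' k (Phi_inv k x))"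

lemma Phi_inverse: "Phi_inv k (Phi k x) = x" "Phi k (Phi_inv k x) = x"
  by (induction k arbitrary: x) (simp_all add: box_twistsD(3,4)[OF twists])

lemma Ck_on_Phi: "Ck_on m (Phi k) UNIV" "Ck_on m (Phi_inv k) UNIV"
proof (induction k)
  case (Suc k)
  {
    case 1
    show ?case
      using Ck_on_compose[OF Suc(1) box_twistsD(1)[OF twists]] by simp
  next
    case 2
    show ?case
      using Ck_on_compose[OF box_twistsD(2)[OF twists] Suc(2)] by simp
  }
qed (simp_all add: Ck_on_ident)

text \<open>The centre goes to its mirror image; for odd \<open>k\<close> the cube is in addition
  reversed along both axes. That reversal already mirrors the children along
  \<open>last_index\<close>, but wrongly also along \<open>i0\<close>, which the flip by
  \<open>F k\<close> along \<open>i0\<close> undoes.\<close>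

lemma Phi_on_cube:
  assumes "c \<in> centers k" "x \<in> cube c (radius k)"
  shows "Phi k x = (\<chi> l. if l = last_index then 1 - c $ l + (-1) ^ k * (x $ l - c $ l)
    else if l = i0 then c $ l + (-1) ^ k * (x $ l - c $ l) else x $ l)"
  using assms
proof (induction k arbitrary: c x)
  case 0
  then have half: "c $ l = 1/2" for l
    by (simp add: centers_def)
  have "1 - c $ l = c $ l" for l
    using half[of l] by linarith
  then show ?case
    by (simp add: vec_eq_iff)
next
  case (Suc k)
  obtain d where d: "d \<in> centers k" "\<And>l. \<bar>c $ l - d $ l\<bar> = radius k / 2"
    using centers_parent[OF Suc.prems(1)] by blast
  have "\<bar>x $ l - d $ l\<bar> \<le> radius k" for l
  proof -
    have "\<bar>x $ l - c $ l\<bar> \<le> radius (Suc k)"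
      using Suc.prems(2) by (simp add: cube_def)
    then show ?thesis
      using d(2)[of l] radius_Suc[of k] by linarith
  qed
  then have "F k x \<in> cube d (radius k)"
    by (intro F_cube d) (auto simp: cube_def)
  note IH = Suc.IH[OF d(1) this]
  have F: "F k x $ l = (if l = turn_axis i0 k then 2 * c $ l - x $ l
      else if l = flip_axis i0 k then 2 * d $ l - x $ l else x $ l)" for l
    by (simp add: F_child[OF Suc.prems(1) d Suc.prems(2)])
  show ?case
    using i0 by (cases "even k") (auto simp: vec_eq_iff IH F turn_axis_def flip_axis_def)
qed

lemma Phi_cube_self:
  assumes "c \<in> centers k" "x \<in> cube c (radius k)"
  shows "Phi k x \<in> cube (reflection c) (radius k)"
proof -
  have "\<bar>(-1) ^ k * (x $ l - c $ l)\<bar> \<le> radius k" for l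
    using assms(2) by (simp add: cube_def abs_mult)
  then show ?thesis
    unfolding Phi_on_cube[OF assms] using assms(2) by (auto simp: cube_def reflection_nth)
qed

lemma Phi_cube:
  assumes "c \<in> centers k" "x \<in> cube c (radius k)" "k \<le> m"
  shows "Phi m x \<in> cube (reflection c) (radius k)"
  using assms(3,2)
proof (induction m arbitrary: x rule: dec_induct)
  case base
  then show ?case
    using assms(1) by (rule Phi_cube_self[rotated])
next
  case (step m)
  then show ?case
    using F_cube[OF _ assms(1)] by simp
qed

lemma Phi_outside:
  assumes "x \<notin> level k" "k \<le> m"
  shows "Phi m x = Phi k x"
  using assms(2)
proof (induction m rule: dec_induct)
  case (step m)
  then have "F m x = x"
    using assms(1) level_antimono[of k m] F_outside by blast
  then show ?case
    using step by simp
qed simp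

lemma Phi_level_iff: "Phi k x \<in> level k \<longleftrightarrow> x \<in> level k"
proof
  assume "x \<in> level k"
  then show "Phi k x \<in> level k"
    unfolding level_def using Phi_cube_self reflection_centers by blast
next
  assume "Phi k x \<in> level k"
  then obtain c where c: "c \<in> centers k" "Phi k x \<in> cube c (radius k)"
    by (auto simp: level_def)
  let ?y = "Phi k x"
  \<comment> \<open>A candidate preimage: the formula of \<open>Phi_on_cube\<close> evaluated at
    \<open>?y\<close>. The reflection is an involution and the sign squares to 1, so
    \<open>Phi k\<close> maps \<open>z\<close> back to \<open>?y\<close>.\<close>
  define z where "z = (\<chi> l. if l = last_index then 1 - c $ l + (-1) ^ k * (?y $ l - c $ l)
    else if l = i0 then c $ l + (-1) ^ k * (?y $ l - c $ l) else ?y $ l)"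
  have "\<bar>(-1) ^ k * (?y $ l - c $ l)\<bar> \<le> radius k" for l
    using c(2) by (simp add: cube_def abs_mult)
  then have z: "z \<in> cube (reflection c) (radius k)"
    using c(2) by (auto simp: cube_def reflection_nth z_def)
  have sq: "(-1) ^ k * ((-1) ^ k * t) = t" for t :: real
    by (simp flip: power_mult_distrib mult.assoc)
  have "Phi k z = ?y"
    unfolding Phi_on_cube[OF reflection_centers[OF c(1)] z]
    using i0 by (auto simp: vec_eq_iff reflection_nth z_def sq)
  then have "z = x"
    by (metis Phi_inverse(1))
  then show "x \<in> level k"
    using z reflection_centers[OF c(1)] by (auto simp: level_def)
qed

section \<open>The limit map, its inverse and its continuity\<close>

definition Phi_lim :: "(real, 'n) vec \<Rightarrow> (real, 'n) vec" where
  "Phi_lim x = (if x \<in> cantor_cube then reflection x else Phi (LEAST k. x \<notin> level k) x)"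

lemma not_cantor_cubeE:
  assumes "x \<notin> cantor_cube"
  obtains k where "x \<notin> level k"
  using assms by (auto simp: cantor_cube_def)

text \<open>The least index in the definition is only a choice: by \<open>Phi_outside\<close> every
  level that misses the point gives the same value.\<close>

lemma Phi_lim_outside:
  assumes "x \<notin> level k"
  shows "Phi_lim x = Phi k x"
proof -
  have "x \<notin> cantor_cube"
    using assms by (auto simp: cantor_cube_def)
  moreover have "x \<notin> level (LEAST k. x \<notin> level k)"
    using assms by (rule LeastI)
  ultimately show ?thesis
    using Phi_outside[OF _ Least_le[of "\<lambda>k. x \<notin> level k", OF assms]] by (simp add: Phi_lim_def)
qed

lemma Phi_lim_cube:
  assumes "c \<in> centers k" "x \<in> cube c (radius k)"
  shows "Phi_lim x \<in> cube (reflection c) (radius k)"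
proof (cases "x \<in> cantor_cube")
  case True
  then show ?thesis
    using assms by (simp add: Phi_lim_def reflection_cube)
next
  case False
  then obtain m where "x \<notin> level m"
    by (rule not_cantor_cubeE)
  then have "x \<notin> level (max k m)"
    using level_antimono[of m "max k m"] by auto
  then show ?thesis
    using Phi_lim_outside Phi_cube[OF assms, of "max k m"] by simp
qed

lemma Phi_lim_cantor_cube: "Phi_lim x \<in> cantor_cube \<longleftrightarrow> x \<in> cantor_cube"
proof (cases "x \<in> cantor_cube")
  case True
  then show ?thesis
    by (simp add: Phi_lim_def reflection_cantor_cube)
next
  case False
  then obtain k where k: "x \<notin> level k"
    by (rule not_cantor_cubeE)
  then have "Phi_lim x \<notin> level k"
    by (simp add: Phi_lim_outside Phi_level_iff)
  with False show ?thesis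
    by (auto simp: cantor_cube_def)
qed

lemma inj_Phi_lim: "inj Phi_lim"
proof (rule injI)
  fix x y assume eq: "Phi_lim x = Phi_lim y"
  show "x = y"
  proof (cases "x \<in> cantor_cube")
    case True
    then have "y \<in> cantor_cube"
      using eq Phi_lim_cantor_cube by metis
    then show ?thesis
      using eq True reflection_involution by (metis Phi_lim_def)
  next
    case False
    then have "y \<notin> cantor_cube"
      using eq Phi_lim_cantor_cube by metis
    with False obtain k m where "x \<notin> level k" "y \<notin> level m"
      by (meson not_cantor_cubeE)
    then have "x \<notin> level (max k m)" "y \<notin> level (max k m)"
      using level_antimono[of m "max k m"] level_antimono[of k "max k m"] by auto
    then have "Phi (max k m) x = Phi (max k m) y"
      using eq by (simp add: Phi_lim_outside)
    then show ?thesis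
      by (metis Phi_inverse(1))
  qed
qed

text \<open>The index for the inverse can be read off from \<open>y\<close>, because
  \<open>Phi k\<close> preserves the complement of \<open>level k\<close>.\<close>

definition Psi :: "(real, 'n) vec \<Rightarrow> (real, 'n) vec" where
  "Psi y = (if y \<in> cantor_cube then reflection y else Phi_inv (LEAST k. y \<notin> level k) y)"

lemma Phi_lim_Psi: "Phi_lim (Psi y) = y"
proof (cases "y \<in> cantor_cube")
  case True
  then show ?thesis
    by (simp add: Psi_def Phi_lim_def reflection_cantor_cube reflection_involution)
next
  case False
  define k where "k = (LEAST k. y \<notin> level k)"
  have "y \<notin> level k"
    using not_cantor_cubeE[OF False] unfolding k_def by (metis (mono_tags, lifting) LeastI)
  then have "Phi_inv k y \<notin> level k"
    using Phi_level_iff[of k "Phi_inv k y"] by (simp add: Phi_inverse)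
  then have "Phi_lim (Phi_inv k y) = y"
    by (simp add: Phi_lim_outside Phi_inverse)
  then show ?thesis
    using False by (simp add: Psi_def k_def)
qed

lemma Psi_Phi_lim: "Psi (Phi_lim x) = x"
  using inj_Phi_lim Phi_lim_Psi by (metis injD)

lemma Psi_outside:
  assumes "y \<notin> level k"
  shows "Psi y = Phi_inv k y"
proof -
  have "Phi_inv k y \<notin> level k"
    using assms Phi_level_iff[of k "Phi_inv k y"] by (simp add: Phi_inverse)
  then have "Phi_lim (Phi_inv k y) = y"
    by (simp add: Phi_lim_outside Phi_inverse)
  then show ?thesis
    by (metis Psi_Phi_lim)
qed

lemma Phi_lim_unit_cube: "Phi_lim ` unit_cube = unit_cube"
proof -
  have level_0: "level 0 \<subseteq> (unit_cube :: (real, 'n) vec set)"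
    using level_0_subset interior_subset by blast
  have "Phi_lim x \<in> unit_cube \<longleftrightarrow> x \<in> unit_cube" for x
  proof (cases "x \<in> level 0")
    case True
    then have "Phi_lim x \<in> level 0"
      unfolding level_def using Phi_lim_cube reflection_centers by blast
    with True level_0 show ?thesis by blast
  qed (simp add: Phi_lim_outside)
  then show ?thesis
    using Phi_lim_Psi by (metis (no_types, lifting) image_iff subsetI subset_antisym)
qed

text \<open>Off the Cantor set the map is locally some \<open>Phi k\<close>. At a point of the set,
  a neighbourhood lies in a cube of level \<open>k\<close> and is sent into the mirror cube, whose
  size tends to 0.\<close>

lemma isCont_Phi_lim: "isCont Phi_lim x"
proof (cases "x \<in> cantor_cube")
  case False
  then obtain k where k: "x \<notin> level k"
    by (rule not_cantor_cubeE)
  have "isCont (Phi k) x"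
    using Ck_on_Phi(1)[of 0 k] by (simp add: continuous_on_eq_continuous_at)
  moreover have "\<forall>\<^sub>F y in nhds x. Phi_lim y = Phi k y"
    using k compact_imp_closed[OF compact_level[of k]]
    unfolding eventually_nhds by (intro exI[of _ "- level k"]) (auto simp: Phi_lim_outside)
  ultimately show ?thesis
    using isCont_cong by blast
next
  case True
  show ?thesis
    unfolding isCont_def tendsto_iff
  proof (intro allI impI)
    fix e :: real assume "e > 0"
    then have "\<forall>\<^sub>F k in sequentially. radius k < e / (2 * CARD('n))"
      by (intro order_tendstoD(2)[OF radius_tendsto_0]) simp
    then obtain k where k: "radius k < e / (2 * CARD('n))"
      by (auto simp: eventually_sequentially)
    \<comment> \<open>One level deeper than \<open>k\<close>: a child stays at distance
      \<open>radius k / 2 - radius (Suc k)\<close> from the boundary of its parent, which leaves a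
      ball about \<open>x\<close> inside the parent.\<close>
    have "x \<in> level (Suc k)"
      using True by (simp add: cantor_cube_def)
    then obtain c' where c': "c' \<in> centers (Suc k)" "x \<in> cube c' (radius (Suc k))"
      by (auto simp: level_def)
    obtain c where c: "c \<in> centers k" "\<And>l. \<bar>c' $ l - c $ l\<bar> = radius k / 2"
      using centers_parent[OF c'(1)] by blast
    define d where "d = radius k / 2 - radius (Suc k)"
    have d: "d > 0"
      using radius_Suc[of k] by (simp add: d_def)
    have near: "y \<in> cube c (radius k)" if "dist y x < d" for y
      unfolding cube_def
    proof (clarify)
      fix l
      have "\<bar>y $ l - x $ l\<bar> \<le> dist y x"
        using component_le_norm_cart[of "y - x" l] by (simp add: dist_norm)
      moreover have "\<bar>x $ l - c' $ l\<bar> \<le> radius (Suc k)"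
        using c'(2) by (simp add: cube_def)
      ultimately show "\<bar>y $ l - c $ l\<bar> \<le> radius k"
        using c(2)[of l] that unfolding d_def by linarith
    qed
    have "dist (Phi_lim y) (Phi_lim x) < e" if "dist y x < d" for y
    proof -
      have "\<bar>(Phi_lim y - Phi_lim x) $ l\<bar> \<le> 2 * radius k" for l
      proof -
        have "\<bar>Phi_lim y $ l - reflection c $ l\<bar> \<le> radius k" "\<bar>Phi_lim x $ l - reflection c $ l\<bar> \<le> radius k"
          using Phi_lim_cube[OF c(1) near[OF that]] Phi_lim_cube[OF c(1) near, of x] d
          by (auto simp: cube_def)
        then show ?thesis by simp
      qed
      then have "(\<Sum>l\<in>UNIV. \<bar>(Phi_lim y - Phi_lim x) $ l\<bar>) \<le> (\<Sum>l\<in>(UNIV :: 'n set). 2 * radius k)"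
        by (intro sum_mono)
      also have "\<dots> < e"
        using k by (simp add: field_simps)
      finally show ?thesis
        using norm_le_l1_cart[of "Phi_lim y - Phi_lim x"] by (simp add: dist_norm)
    qed
    then show "\<forall>\<^sub>F y in at x. dist (Phi_lim y) (Phi_lim x) < e"
      using d by (auto simp: eventually_at)
  qed
qed

end

section \<open>Density points and approximate derivatives\<close>

text \<open>Balls in which a fixed proportion of the volume lies outside \<open>E\<close> form a Vitali cover of
  the exceptional set, inside an open \<open>U \<supseteq> E\<close> with \<open>U - E\<close> as small as desired.\<close>

lemma negligible_low_density:
  fixes E :: "'a::euclidean_space set"
  assumes E: "E \<in> sets lebesgue" and c: "c > 0" and N: "N \<subseteq> E"
    and low: "\<And>x d. x \<in> N \<Longrightarrow> d > 0 \<Longrightarrow>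
      \<exists>r. 0 < r \<and> r < d \<and> c * measure lebesgue (ball x r) \<le> measure lebesgue (ball x r - E)"
  shows "negligible N"
  unfolding negligible_outer_le
proof (intro allI impI)
  fix e :: real assume "e > 0"
  \<comment> \<open>The bound \<open>c * e\<close> is chosen because at least the proportion
    \<open>c\<close> of each covering ball lies in \<open>U - E\<close>; disjoint balls then have
    total measure at most \<open>e\<close>.\<close>
  then obtain U where U: "open U" "E \<subseteq> U" "U - E \<in> lmeasurable" "emeasure lebesgue (U - E) < ennreal (c * e)"
    using sets_lebesgue_outer_open[OF E, of "c * e"] c by auto
  define K where "K = {(x, r). ball x r \<subseteq> U \<and> 0 < r \<and>
      c * measure lebesgue (ball x r) \<le> measure lebesgue (ball x r - E)}"
  obtain C where C: "countable C" "C \<subseteq> K"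
      "pairwise (\<lambda>i j. disjnt (ball (fst i) (snd i)) (ball (fst j) (snd j))) C"
      "negligible (N - (\<Union>i\<in>C. ball (fst i) (snd i)))"
  proof (rule Vitali_covering_theorem_balls[of N K fst snd])
    fix x and d :: real assume x: "x \<in> N" "d > 0"
    then obtain d' where d': "d' > 0" "ball x d' \<subseteq> U"
      using N U openE by blast
    then obtain r where r: "0 < r" "r < min d d'"
        "c * measure lebesgue (ball x r) \<le> measure lebesgue (ball x r - E)"
      using low[of x "min d d'"] x by auto
    then have "(x, r) \<in> K"
      using d' subset_ball[of r d' x] by (auto simp: K_def)
    then show "\<exists>i. i \<in> K \<and> x \<in> ball (fst i) (snd i) \<and> snd i < d"
      using r by force
  qed
  let ?B = "\<lambda>i. ball (fst i) (snd i)"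
  have disj: "disjoint_family_on ?B C"
    using C(3) by (auto simp: disjoint_family_on_def pairwise_def disjnt_def)
  have BU: "?B i \<subseteq> U" if "i \<in> C" for i
    using subsetD[OF C(2) that] by (auto simp: K_def)
  have meas: "?B i - E \<in> lmeasurable" for i
    using E by (intro fmeasurable_Diff) auto
  have le: "ennreal c * emeasure lebesgue (?B i) \<le> emeasure lebesgue (?B i - E)" if "i \<in> C" for i
  proof -
    have "c * measure lebesgue (?B i) \<le> measure lebesgue (?B i - E)"
      using subsetD[OF C(2) that] by (auto simp: K_def)
    then have "ennreal (c * measure lebesgue (?B i)) \<le> ennreal (measure lebesgue (?B i - E))"
      by (rule ennreal_leI)
    then show ?thesis
      using c meas by (simp add: ennreal_mult emeasure_eq_measure2)
  qed
  have "ennreal c * emeasure lebesgue (\<Union>i\<in>C. ?B i)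
      = (\<integral>\<^sup>+i. ennreal c * emeasure lebesgue (?B i) \<partial>count_space C)"
    using C(1) disj by (subst emeasure_UN_countable) (auto simp: nn_integral_cmult)
  also have "\<dots> \<le> (\<integral>\<^sup>+i. emeasure lebesgue (?B i - E) \<partial>count_space C)"
    using le by (intro nn_integral_mono) auto
  also have "\<dots> = emeasure lebesgue (\<Union>i\<in>C. ?B i - E)"
    using C(1) disjoint_family_on_bisimulation[OF disj, of "\<lambda>i. ?B i - E"] meas
    by (subst emeasure_UN_countable) (auto simp: fmeasurableD)
  also have "\<dots> \<le> emeasure lebesgue (U - E)"
    using BU U(3) by (intro emeasure_mono) (auto simp: fmeasurableD)
  also have "\<dots> \<le> ennreal c * ennreal e"
    using U(4) c \<open>e > 0\<close> by (simp add: ennreal_mult)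
  finally have le: "emeasure lebesgue (\<Union>i\<in>C. ?B i) \<le> ennreal e"
    using c by (simp add: ennreal_mult_le_mult_iff)
  have UB: "(\<Union>i\<in>C. ?B i) \<in> sets lebesgue"
    using C(1) by auto
  let ?T = "(\<Union>i\<in>C. ?B i) \<union> (N - (\<Union>i\<in>C. ?B i))"
  have "emeasure lebesgue ?T = emeasure lebesgue (\<Union>i\<in>C. ?B i)"
    using C(4) UB by (intro emeasure_Un_null_set) (auto simp: negligible_iff_null_sets)
  with le have *: "emeasure lebesgue ?T \<le> ennreal e" by simp
  have "?T \<in> sets lebesgue"
    using UB C(4) by (intro sets.Un) (auto simp: negligible_imp_sets)
  then have "?T \<in> lmeasurable"
    using * by (intro fmeasurableI) (auto simp: le_less_trans less_top)
  moreover have "measure lebesgue ?T \<le> e"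
    using * \<open>e > 0\<close> calculation by (simp add: emeasure_eq_measure2)
  ultimately show "\<exists>T. N \<subseteq> T \<and> T \<in> lmeasurable \<and> measure lebesgue T \<le> e"
    by (intro exI[of _ ?T]) auto
qed

lemma measure_ball_split:
  fixes E :: "'a::euclidean_space set"
  assumes "E \<in> sets lebesgue"
  shows "measure lebesgue (ball x r) = measure lebesgue (E \<inter> ball x r) + measure lebesgue (ball x r - E)"
proof -
  have "measure lebesgue (E \<inter> ball x r \<union> (ball x r - E))
      = measure lebesgue (E \<inter> ball x r) + measure lebesgue (ball x r - E)"
    using assms fmeasurable_Int_fmeasurable[of "ball x r" lebesgue E]
    by (intro measure_Un2[THEN trans] arg_cong2[of _ _ _ _ "(+)"] arg_cong[of _ _ "measure lebesgue"])
       (auto simp: Int_commute intro: fmeasurable_Diff)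
  moreover have "E \<inter> ball x r \<union> (ball x r - E) = ball x r" by auto
  ultimately show ?thesis by simp
qed

text \<open>Passing to the relative measure of the complement makes density usable with
  subadditivity, as for intersections.\<close>

lemma density_point_iff:
  "density_point x E \<longleftrightarrow> E \<in> sets lebesgue \<and>
     (\<forall>c>0. \<exists>d>0. \<forall>r. 0 < r \<and> r < d \<longrightarrow>
        measure lebesgue (ball x r - E) < c * measure lebesgue (ball x r))"
proof (cases "E \<in> sets lebesgue")
  case True
  have "dist (measure lebesgue (E \<inter> ball x r) / measure lebesgue (ball x r)) 1 < c
      \<longleftrightarrow> measure lebesgue (ball x r - E) < c * measure lebesgue (ball x r)" if "r > 0" for r c
  proof -
    have "measure lebesgue (ball x r) > 0"
      using that by (simp add: content_ball_pos measure_completion)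
    then show ?thesis
      using measure_ball_split[OF True, of x r] measure_nonneg[of lebesgue "ball x r - E"]
      by (simp add: dist_real_def divide_diff_eq_iff abs_divide pos_divide_less_eq)
  qed
  then show ?thesis
    unfolding density_point_def tendsto_iff eventually_at_right_field
    using True by (auto; metis)
qed (simp add: density_point_def)

text \<open>Failure of density means a fixed proportion \<open>c\<close> of complement in
  arbitrarily small balls; the values \<open>1 / (n + 1)\<close> of \<open>c\<close> suffice, which
  leaves countably many null sets.\<close>

theorem lebesgue_density:
  fixes E :: "'a::euclidean_space set"
  assumes E: "E \<in> sets lebesgue"
  shows "negligible {x \<in> E. \<not> density_point x E}"
proof -
  define N where "N c = {x \<in> E. \<forall>d>0. \<exists>r. 0 < r \<and> r < d \<and>
      c * measure lebesgue (ball x r) \<le> measure lebesgue (ball x r - E)}" for c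
  have "negligible (N c)" if "c > 0" for c
    by (rule negligible_low_density[OF E that]) (auto simp: N_def)
  then have "negligible (\<Union>n. N (inverse (Suc n)))"
    by (intro negligible_countable_Union) auto
  moreover have "{x \<in> E. \<not> density_point x E} \<subseteq> (\<Union>n. N (inverse (Suc n)))"
  proof
    fix x assume x: "x \<in> {x \<in> E. \<not> density_point x E}"
    then obtain c where c: "c > 0" "\<forall>d>0. \<exists>r. 0 < r \<and> r < d \<and>
        c * measure lebesgue (ball x r) \<le> measure lebesgue (ball x r - E)"
      using E by (simp only: density_point_iff mem_Collect_eq) (meson not_less)
    obtain n where n: "inverse (Suc n) < c"
      using reals_Archimedean[OF c(1)] by auto
    have "x \<in> N (inverse (Suc n))"
      unfolding N_def
    proof (safe)
      fix d :: real assume "d > 0"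
      then obtain r where "0 < r" "r < d"
        "c * measure lebesgue (ball x r) \<le> measure lebesgue (ball x r - E)"
        using c by auto
      moreover have "inverse (Suc n) * measure lebesgue (ball x r) \<le> c * measure lebesgue (ball x r)"
        using n by (intro mult_right_mono) auto
      ultimately show "\<exists>r>0. r < d \<and> inverse (Suc n) * measure lebesgue (ball x r)
          \<le> measure lebesgue (ball x r - E)"
        by (meson order_trans)
    qed (use x in auto)
    then show "x \<in> (\<Union>n. N (inverse (Suc n)))" by blast
  qed
  ultimately show ?thesis
    by (rule negligible_subset)
qed

lemma interior_imp_density_point:
  assumes "x \<in> interior E" "E \<in> sets lebesgue"
  shows "density_point x E"
proof -
  obtain d where d: "d > 0" "ball x d \<subseteq> E"
    using assms by (auto simp: mem_interior)
  have "ball x r - E = {}" "measure lebesgue (ball x r) > 0" if "0 < r" "r < d" for r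
    using that d subset_ball[of r d x] by (auto simp: content_ball_pos measure_completion)
  then show ?thesis
    using d assms unfolding density_point_iff by (metis measure_empty mult_pos_pos)
qed

lemma density_point_Int:
  assumes "density_point x E" "density_point x F"
  shows "density_point x (E \<inter> F)"
  unfolding density_point_iff
proof (intro conjI allI impI)
  show EF: "E \<inter> F \<in> sets lebesgue"
    using assms by (auto simp: density_point_iff)
  fix c :: real assume c: "c > 0"
  obtain d1 where d1: "d1 > 0" "\<And>r. 0 < r \<Longrightarrow> r < d1 \<Longrightarrow>
      measure lebesgue (ball x r - E) < c/2 * measure lebesgue (ball x r)"
    using assms(1) c half_gt_zero[OF c] unfolding density_point_iff by meson
  obtain d2 where d2: "d2 > 0" "\<And>r. 0 < r \<Longrightarrow> r < d2 \<Longrightarrow>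
      measure lebesgue (ball x r - F) < c/2 * measure lebesgue (ball x r)"
    using assms(2) c half_gt_zero[OF c] unfolding density_point_iff by meson
  show "\<exists>d>0. \<forall>r. 0 < r \<and> r < d \<longrightarrow>
      measure lebesgue (ball x r - E \<inter> F) < c * measure lebesgue (ball x r)"
  proof (intro exI[of _ "min d1 d2"] conjI allI impI)
    fix r assume r: "0 < r \<and> r < min d1 d2"
    have "measure lebesgue (ball x r - E \<inter> F) \<le>
        measure lebesgue (ball x r - E) + measure lebesgue (ball x r - F)"
      unfolding Diff_Int using assms
      by (intro measure_Un_le) (auto simp: density_point_iff)
    then show "measure lebesgue (ball x r - E \<inter> F) < c * measure lebesgue (ball x r)"
      using d1(2)[of r] d2(2)[of r] r by simp
  qed (use d1 d2 in auto)
qed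

text \<open>The ball of radius \<open>t \<rho>\<close> about \<open>x + (\<rho>/2) v\<close> has a fixed proportion of the volume of
  \<open>ball x \<rho>\<close>, so a set of density 1 at \<open>x\<close> meets it.\<close>

lemma density_point_meets_cone:
  fixes x v :: "'a::euclidean_space"
  assumes "density_point x E" "norm v = 1" "e > 0" "0 < t" "t \<le> 1/2"
  obtains \<rho> y where "0 < \<rho>" "\<rho> < e" "y \<in> E" "norm (y - x - (\<rho>/2) *\<^sub>R v) < t * \<rho>"
proof -
  \<comment> \<open>The small ball has the proportion \<open>t ^ DIM('a)\<close> of the volume; half
    of it suffices for a contradiction if \<open>E\<close> misses that ball.\<close>
  define c where "c = t ^ DIM('a) / 2"
  have "c > 0" using assms by (simp add: c_def)
  then obtain d where d: "d > 0" "\<And>r. 0 < r \<Longrightarrow> r < d \<Longrightarrow>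
      measure lebesgue (ball x r - E) < c * measure lebesgue (ball x r)"
    using assms(1) unfolding density_point_iff by meson
  define \<rho> where "\<rho> = min d e / 2"
  have \<rho>: "\<rho> > 0" "\<rho> < d" "\<rho> < e"
    using d assms by (auto simp: \<rho>_def)
  let ?B = "ball (x + (\<rho>/2) *\<^sub>R v) (t * \<rho>)"
  have "?B \<subseteq> ball x \<rho>"
  proof
    fix y assume "y \<in> ?B"
    then have "norm (y - x) < t * \<rho> + \<rho> / 2"
      using norm_triangle_ineq[of "y - (x + (\<rho>/2) *\<^sub>R v)" "(\<rho>/2) *\<^sub>R v"] assms(2) \<rho>
      by (simp add: dist_norm norm_minus_commute)
    also have "\<dots> \<le> \<rho>"
      using mult_right_mono[OF assms(5), of \<rho>] \<rho> by linarith
    finally show "y \<in> ball x \<rho>"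
      by (simp add: dist_norm norm_minus_commute)
  qed
  have "?B \<inter> E \<noteq> {}"
  proof
    assume "?B \<inter> E = {}"
    then have "measure lebesgue ?B \<le> measure lebesgue (ball x \<rho> - E)"
      using \<open>?B \<subseteq> ball x \<rho>\<close> assms(1)
      by (intro measure_mono_fmeasurable) (auto intro: fmeasurable_Diff simp: density_point_iff)
    also have "\<dots> < c * measure lebesgue (ball x \<rho>)"
      using d \<rho> by blast
    also have "\<dots> = measure lebesgue ?B / 2"
      using \<rho> assms by (simp add: content_ball measure_completion c_def power_mult_distrib)
    finally show False
      using measure_nonneg[of lebesgue ?B] by linarith
  qed
  then obtain y where "y \<in> E" "y \<in> ?B" by blast
  then show thesis
    using that[of \<rho> y] \<rho> by (simp add: dist_norm norm_minus_commute algebra_simps)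
qed

text \<open>The difference \<open>M\<close> of two candidates is of smaller order than the distance
  along a set of density 1. That set has points near \<open>x\<close> close to any direction
  \<open>v\<close>, where a nonzero \<open>M v\<close> would force linear growth.\<close>

lemma has_ap_derivative_unique:
  assumes "has_ap_derivative f L E x" "has_ap_derivative f L' E x"
  shows "L = L'"
proof -
  obtain F where F: "density_point x F" "((\<lambda>y. \<bar>f y - f x - L (y - x)\<bar> / norm (y - x)) \<longlongrightarrow> 0) (at x within F)"
    using assms(1) unfolding has_ap_derivative_def by blast
  obtain G where G: "density_point x G" "((\<lambda>y. \<bar>f y - f x - L' (y - x)\<bar> / norm (y - x)) \<longlongrightarrow> 0) (at x within G)"
    using assms(2) unfolding has_ap_derivative_def by blast
  define M where "M h = L h - L' h" for h
  have M: "linear M"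
    using assms unfolding has_ap_derivative_def M_def by (auto intro: linear_compose_sub)
  define H where "H = F \<inter> G"
  have H: "density_point x H"
    using F G density_point_Int by (simp add: H_def)
  have "((\<lambda>y. \<bar>f y - f x - L (y - x)\<bar> / norm (y - x) + \<bar>f y - f x - L' (y - x)\<bar> / norm (y - x)) \<longlongrightarrow> 0 + 0) (at x within H)"
    by (intro tendsto_add F(2)[THEN tendsto_within_subset] G(2)[THEN tendsto_within_subset]) (auto simp: H_def)
  then have "((\<lambda>y. \<bar>f y - f x - L (y - x)\<bar> / norm (y - x) + \<bar>f y - f x - L' (y - x)\<bar> / norm (y - x)) \<longlongrightarrow> 0) (at x within H)"
    by simp
  note * = this
  have le: "norm (\<bar>M (y - x)\<bar> / norm (y - x)) \<le>
      \<bar>f y - f x - L (y - x)\<bar> / norm (y - x) + \<bar>f y - f x - L' (y - x)\<bar> / norm (y - x)" for y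
    unfolding M_def by (auto simp flip: add_divide_distrib intro!: divide_right_mono)
  from * have lim: "((\<lambda>y. \<bar>M (y - x)\<bar> / norm (y - x)) \<longlongrightarrow> 0) (at x within H)"
    by (rule Lim_null_comparison[OF always_eventually[OF allI[OF le]]])
  have zero: "M v = 0" if v: "norm v = 1" for v
  proof (rule ccontr)
    assume nz: "M v \<noteq> 0"
    obtain K where K: "K > 0" "\<And>h. norm (M h) \<le> norm h * K"
      using M linear_conv_bounded_linear bounded_linear.pos_bounded by blast
    define a where "a = \<bar>M v\<bar>"
    have a: "a > 0" using nz by (simp add: a_def)
    obtain d where d: "d > 0"
        "\<And>y. y \<in> H \<Longrightarrow> y \<noteq> x \<Longrightarrow> dist y x < d \<Longrightarrow> \<bar>M (y - x)\<bar> / norm (y - x) < a / 4"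
    proof -
      have "\<forall>\<^sub>F y in at x within H. dist (\<bar>M (y - x)\<bar> / norm (y - x)) 0 < a / 4"
        using lim a by (intro tendstoD) auto
      then show ?thesis
        using that by (auto simp: eventually_at)
    qed
    \<comment> \<open>With \<open>K * t\<close> at most \<open>a / 4\<close>, deviating from the
      direction \<open>v\<close> costs at most half of the main term
      \<open>a / 2 * \<rho>\<close>.\<close>
    define t where "t = min (1/2) (a / (4 * K))"
    have t: "0 < t" "t \<le> 1/2" "K * t \<le> a / 4"
      using a K by (auto simp: t_def min_def field_simps)
    obtain \<rho> y where y: "0 < \<rho>" "\<rho> < d" "y \<in> H" "norm (y - x - (\<rho>/2) *\<^sub>R v) < t * \<rho>"
      using density_point_meets_cone[OF H v d(1) t(1,2)] by blast
    have "M (y - x) = M (y - x - (\<rho>/2) *\<^sub>R v) + (\<rho>/2) * M v"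
      using M by (simp add: linear_diff linear_scale)
    moreover have "\<bar>M (y - x - (\<rho>/2) *\<^sub>R v)\<bar> \<le> a / 4 * \<rho>"
    proof -
      have "\<bar>M (y - x - (\<rho>/2) *\<^sub>R v)\<bar> \<le> (t * \<rho>) * K"
        using K(2)[of "y - x - (\<rho>/2) *\<^sub>R v"] mult_right_mono[OF less_imp_le[OF y(4)] less_imp_le[OF K(1)]]
        unfolding real_norm_def by linarith
      also have "\<dots> \<le> a / 4 * \<rho>"
        using mult_right_mono[OF t(3), of \<rho>] y(1) by (simp add: mult_ac)
      finally show ?thesis .
    qed
    moreover have "\<bar>(\<rho>/2) * M v\<bar> = a / 2 * \<rho>"
      using y(1) by (simp add: abs_mult a_def)
    ultimately have large: "\<bar>M (y - x)\<bar> \<ge> a / 4 * \<rho>"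
      by linarith
    have "norm (y - x) \<le> t * \<rho> + \<rho> / 2"
      using norm_triangle_ineq[of "y - x - (\<rho>/2) *\<^sub>R v" "(\<rho>/2) *\<^sub>R v"] v y by simp
    also have "\<dots> \<le> \<rho>"
      using mult_right_mono[OF t(2), of \<rho>] y by linarith
    finally have small: "norm (y - x) \<le> \<rho>" .
    have "a / 4 * \<rho> > 0"
      using a y by simp
    then have "y \<noteq> x"
      using large M by (auto simp: linear_0)
    then have "\<bar>M (y - x)\<bar> < a / 4 * norm (y - x)"
      using d(2)[of y] y small by (simp add: dist_norm divide_less_eq)
    also have "\<dots> \<le> a / 4 * \<rho>"
      using small a by simp
    finally show False
      using large by simp
  qed
  have "M h = 0" for h
  proof (cases "h = 0")
    case False
    then have "M (h /\<^sub>R norm h) = 0"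
      by (intro zero) simp
    with False M show ?thesis
      by (simp add: linear_scale)
  qed (use M linear_0 in auto)
  then show ?thesis
    by (auto simp: M_def fun_eq_iff)
qed

lemma ap_D_eqI: "has_ap_derivative f L E x \<Longrightarrow> ap_D f E x = L"
  unfolding ap_D_def using has_ap_derivative_unique by blast

lemma has_derivative_imp_has_ap_derivative:
  fixes f :: "'a::euclidean_space \<Rightarrow> real"
  assumes "(f has_derivative L) (at x)" "x \<in> interior E" "E \<in> sets lebesgue"
    "f \<in> borel_measurable (lebesgue_on E)"
  shows "has_ap_derivative f L E x"
proof -
  have "((\<lambda>y. norm (f y - f x - L (y - x)) / norm (y - x)) \<longlongrightarrow> 0) (at x)"
    using assms(1) by (simp add: has_derivative_iff_norm)
  then have "((\<lambda>y. \<bar>f y - f x - L (y - x)\<bar> / norm (y - x)) \<longlongrightarrow> 0) (at x within E)"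
    by (auto intro: tendsto_within_subset)
  then show ?thesis
    unfolding has_ap_derivative_def
    using assms interior_imp_density_point[OF assms(2,3)] interior_subset[of E]
      has_derivative_linear by blast
qed

lemma has_ap_derivative_affine_on:
  fixes f :: "'a::euclidean_space \<Rightarrow> real"
  assumes "density_point x F" "F \<subseteq> E" "x \<in> F" "linear L"
    "\<And>y. y \<in> F \<Longrightarrow> f y - f x = L (y - x)"
    "E \<in> sets lebesgue" "f \<in> borel_measurable (lebesgue_on E)"
  shows "has_ap_derivative f L E x"
proof -
  have "((\<lambda>y. \<bar>f y - f x - L (y - x)\<bar> / norm (y - x)) \<longlongrightarrow> 0) (at x within F)"
    by (rule tendsto_eventually) (auto simp: eventually_at_filter assms(5))
  then show ?thesis
    unfolding has_ap_derivative_def using assms density_point_def by blast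
qed

section \<open>Properties of the limit map\<close>

lemma unit_cube_eq_cbox: "unit_cube = cbox 0 (1 :: real^'n::finite)"
  by (auto simp: unit_cube_def mem_box_cart)

lemma Ck_on_reflection: "Ck_on k (reflection :: (real, 'n::{finite,linorder}) vec \<Rightarrow> _) UNIV"
proof -
  have "Ck_on k (\<lambda>x::(real, 'n) vec. if i = last_index then 1 - x $ i else x $ i) UNIV" for i
    by (cases "i = last_index") (simp_all add: Ck_on_diff Ck_on_const Ck_on_nth Ck_on_ident)
  then show ?thesis
    unfolding reflection_def[abs_def] by (rule Ck_on_vec_lambda)
qed

context cantor_twists
begin

lemma Phi_lim_differentiable:
  assumes "x \<notin> cantor_cube"
  shows "Phi_lim differentiable at x"
proof -
  obtain k where k: "x \<notin> level k"
    using not_cantor_cubeE[OF assms] .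
  obtain D where "(Phi k has_derivative D) (at x)"
    using Ck_on_Phi(1)[of "Suc 0" k] by (auto simp: differentiable_def)
  then have "(Phi_lim has_derivative D) (at x)"
    by (rule has_derivative_transform_within_open[where s = "- level k"])
       (use k compact_imp_closed[OF compact_level[of k]] in \<open>auto simp: Phi_lim_outside\<close>)
  then show ?thesis
    by (auto simp: differentiable_def)
qed

lemma continuous_on_Phi_lim: "continuous_on S Phi_lim"
  using isCont_Phi_lim by (simp add: continuous_at_imp_continuous_on)

lemma homeomorphism_Phi_lim: "homeomorphism unit_cube unit_cube Phi_lim Psi"
proof -
  \<comment> \<open>Compactness of the cube gives continuity of the inverse without any estimate for
    \<open>Psi\<close>.\<close>
  have "continuous_on (Phi_lim ` unit_cube) Psi"
    by (rule continuous_on_inv) (simp_all add: continuous_on_Phi_lim Psi_Phi_lim unit_cube_eq_cbox)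
  moreover have "Psi ` unit_cube = unit_cube"
    using Phi_lim_unit_cube Psi_Phi_lim by (metis (no_types, lifting) image_cong image_ident image_image)
  ultimately show ?thesis
    using Phi_lim_unit_cube
    by (auto simp: homeomorphism_def continuous_on_Phi_lim Psi_Phi_lim Phi_lim_Psi)
qed

lemma smooth_diffeomorphism_Phi_lim:
  "smooth_diffeomorphism Phi_lim (unit_cube - cantor_cube) (Phi_lim ` (unit_cube - cantor_cube))"
  unfolding smooth_diffeomorphism_def
proof (intro exI[of _ Psi] conjI)
  \<comment> \<open>One statement serves both directions: the complement of \<open>level k\<close>
    is open, and the globally smooth \<open>g k\<close> is the local extension there.\<close>
  have smooth: "smooth_on f S" if S: "S \<inter> cantor_cube = {}"
      and f: "\<And>k x. x \<notin> level k \<Longrightarrow> f x = g k x" "\<And>m k. Ck_on m (g k) UNIV"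
    for f :: "(real, 'n) vec \<Rightarrow> (real, 'n) vec" and g S
    unfolding smooth_on_def
  proof
    fix x assume "x \<in> S"
    then obtain k where k: "x \<notin> level k"
      using S not_cantor_cubeE by blast
    show "\<exists>U g. open U \<and> x \<in> U \<and> (\<forall>k. Ck_on k g U) \<and> (\<forall>y\<in>U \<inter> S. g y = f y)"
      using k f Ck_on_mono[OF f(2)] compact_imp_closed[OF compact_level[of k]]
      by (intro exI[of _ "- level k"] exI[of _ "g k"]) auto
  qed
  show "smooth_on Phi_lim (unit_cube - cantor_cube)"
    by (rule smooth[of _ _ Phi]) (auto simp: Phi_lim_outside Ck_on_Phi)
  show "smooth_on Psi (Phi_lim ` (unit_cube - cantor_cube))"
    by (rule smooth[of _ _ Phi_inv]) (auto simp: Psi_outside Ck_on_Phi Phi_lim_cantor_cube)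
  show "homeomorphism (unit_cube - cantor_cube) (Phi_lim ` (unit_cube - cantor_cube)) Phi_lim Psi"
    by (rule homeomorphism_of_subsets[OF homeomorphism_Phi_lim, where T'' = unit_cube]) auto
qed

text \<open>A null set is split along the Cantor set. On it the map is the reflection, off it the
  map is differentiable, and differentiable maps send null sets to null sets.\<close>

lemma lusin_N_Phi_lim: "lusin_N_on S Phi_lim"
  unfolding lusin_N_on_def negligible_iff_null_sets[symmetric]
proof (intro allI impI)
  fix N :: "(real, 'n) vec set" assume N: "N \<subseteq> S \<and> negligible N"
  have "negligible (reflection ` (N \<inter> cantor_cube))"
    using N Ck_on_reflection[of "Suc 0"]
    by (intro negligible_differentiable_image_negligible)
       (auto simp: negligible_Int differentiable_on_def intro: differentiable_at_withinI)
  moreover have "negligible (Phi_lim ` (N - cantor_cube))"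
    using N Phi_lim_differentiable
    by (intro negligible_differentiable_image_negligible)
       (auto simp: negligible_diff differentiable_on_def intro: differentiable_at_withinI)
  moreover have "Phi_lim ` N = reflection ` (N \<inter> cantor_cube) \<union> Phi_lim ` (N - cantor_cube)"
    by (auto simp: Phi_lim_def)
  ultimately show "negligible (Phi_lim ` N)"
    by (simp add: negligible_Un)
qed

lemma Phi_lim_nth_measurable: "(\<lambda>y. Phi_lim y $ i) \<in> borel_measurable (lebesgue_on unit_cube)"
  by (intro continuous_imp_measurable_on_sets_lebesgue continuous_on_component continuous_on_Phi_lim)
     (simp add: unit_cube_eq_cbox)

lemma unit_cube_lebesgue: "unit_cube \<in> sets lebesgue"
  by (simp add: unit_cube_eq_cbox)

lemma cantor_cube_subset: "cantor_cube \<subseteq> interior (unit_cube :: (real, 'n) vec set)"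
  using level_0_subset by (auto simp: cantor_cube_def)

lemma Phi_lim_ap_differentiable_off:
  assumes "x \<in> interior unit_cube" "x \<notin> cantor_cube"
  shows "ap_differentiable_map Phi_lim unit_cube x"
proof -
  obtain D where D: "(Phi_lim has_derivative D) (at x)"
    using Phi_lim_differentiable[OF assms(2)] by (auto simp: differentiable_def)
  have "has_ap_derivative (\<lambda>y. Phi_lim y $ i) (\<lambda>h. D h $ i) unit_cube x" for i
    by (intro has_derivative_imp_has_ap_derivative assms unit_cube_lebesgue Phi_lim_nth_measurable
        bounded_linear.has_derivative[OF bounded_linear_vec_nth D])
  then show ?thesis
    by (auto simp: ap_differentiable_map_def ap_differentiable_def)
qed

lemma Phi_lim_has_ap_derivative:
  assumes "density_point x cantor_cube" "x \<in> cantor_cube"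
  shows "has_ap_derivative (\<lambda>y. Phi_lim y $ i) (\<lambda>h. if i = last_index then - h $ i else h $ i) unit_cube x"
proof (rule has_ap_derivative_affine_on[OF assms(1) _ assms(2)])
  show "cantor_cube \<subseteq> (unit_cube :: (real, 'n) vec set)"
    using cantor_cube_subset interior_subset by blast
  show "linear (\<lambda>h :: (real, 'n) vec. if i = last_index then - h $ i else h $ i)"
    by (rule linearI) auto
  show "Phi_lim y $ i - Phi_lim x $ i = (if i = last_index then - (y - x) $ i else (y - x) $ i)"
    if "y \<in> cantor_cube" for y
    using that assms(2) by (simp add: Phi_lim_def reflection_nth)
qed (simp_all add: unit_cube_lebesgue Phi_lim_nth_measurable)

lemma Phi_lim_ap_differentiable_on:
  assumes "density_point x cantor_cube" "x \<in> cantor_cube"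
  shows "ap_differentiable_map Phi_lim unit_cube x" "ap_D_matrix Phi_lim unit_cube x = reflection_matrix"
proof -
  note D = Phi_lim_has_ap_derivative[OF assms]
  show "ap_differentiable_map Phi_lim unit_cube x"
    using D by (auto simp: ap_differentiable_map_def ap_differentiable_def)
  show "ap_D_matrix Phi_lim unit_cube x = reflection_matrix"
    by (auto simp: ap_D_matrix_def reflection_matrix_def ap_D_eqI[OF D] vec_eq_iff axis_def)
qed

end

lemma AE_lebesgue_onI:
  assumes "S \<in> sets lebesgue" "negligible N" "\<And>x. x \<in> S \<Longrightarrow> x \<notin> N \<Longrightarrow> P x"
  shows "AE x in lebesgue_on S. P x"
proof -
  have "AE x in lebesgue. x \<in> S \<longrightarrow> P x"
    using assms by (intro AE_I'[of N]) (auto simp: negligible_iff_null_sets)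
  then show ?thesis
    using assms(1) by (simp add: AE_restrict_space_iff)
qed

theorem lemma2p1:
  assumes "CARD('n::{finite,linorder}) \<ge> 2"
  shows "\<exists>(\<Phi> :: (real, 'n) vec \<Rightarrow> (real, 'n) vec) A.
     (\<exists>\<Psi>. homeomorphism unit_cube unit_cube \<Phi> \<Psi>) \<and>
     (AE x in lebesgue_on unit_cube. ap_differentiable_map \<Phi> unit_cube x) \<and>
     lusin_N_on unit_cube \<Phi> \<and>
     compact A \<and> A \<subseteq> interior unit_cube \<and>
     (\<exists>U. open U \<and> frontier unit_cube \<subseteq> U \<and> (\<forall>x\<in>U \<inter> unit_cube. \<Phi> x = x)) \<and>
     measure lebesgue A = (1/2) ^ CARD('n) \<and>
     (\<forall>x\<in>A. \<Phi> x = reflection x) \<and> \<Phi> ` A = A \<and>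
     smooth_diffeomorphism \<Phi> (unit_cube - A) (\<Phi> ` (unit_cube - A)) \<and>
     (AE x in lebesgue_on A. ap_differentiable_map \<Phi> unit_cube x \<and>
        ap_D_matrix \<Phi> unit_cube x = reflection_matrix)"
proof -
  have "UNIV \<noteq> {last_index :: 'n}"
    using assms by (metis One_nat_def Suc_1 card_1_singleton_iff not_less_eq_eq order_refl)
  then obtain i0 :: 'n where "i0 \<noteq> last_index"
    by blast
  then obtain F F' where "cantor_twists i0 F F'"
    using cantor_twists_exist by blast
  then interpret cantor_twists i0 F F' .
  define A :: "(real, 'n) vec set" where "A = cantor_cube"
  define N where "N = {x \<in> A. \<not> density_point x A}"
  have A_lebesgue: "A \<in> sets lebesgue"
    unfolding A_def by (intro fmeasurableD lmeasurable_compact compact_cantor_cube)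
  have N: "negligible N"
    unfolding N_def by (rule lebesgue_density[OF A_lebesgue])
  show ?thesis
  proof (rule exI[of _ Phi_lim], rule exI[of _ A], intro conjI)
    show "\<exists>\<Psi>. homeomorphism unit_cube unit_cube Phi_lim \<Psi>"
      using homeomorphism_Phi_lim by blast
    show "AE x in lebesgue_on unit_cube. ap_differentiable_map Phi_lim unit_cube x"
    proof (rule AE_lebesgue_onI[OF unit_cube_lebesgue])
      \<comment> \<open>Exceptional points are those on the boundary of the cube, where the cube
        itself lacks density 1, and the points of \<open>A\<close> at which \<open>A\<close> lacks
        density 1.\<close>
      show "negligible ((cbox 0 1 - box 0 1) \<union> N)"
        by (intro negligible_Un N negligible_frontier_interval)
      fix x :: "(real, 'n) vec" assume "x \<in> unit_cube" "x \<notin> (cbox 0 1 - box 0 1) \<union> N"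
      then have "x \<in> interior unit_cube" "x \<notin> N"
        by (auto simp: unit_cube_eq_cbox)
      then show "ap_differentiable_map Phi_lim unit_cube x"
        using Phi_lim_ap_differentiable_off Phi_lim_ap_differentiable_on(1)
        by (cases "x \<in> A") (auto simp: N_def A_def)
    qed
    show "AE x in lebesgue_on A. ap_differentiable_map Phi_lim unit_cube x \<and>
        ap_D_matrix Phi_lim unit_cube x = reflection_matrix"
      by (rule AE_lebesgue_onI[OF A_lebesgue N])
         (simp add: N_def A_def Phi_lim_ap_differentiable_on)
    \<comment> \<open>Off \<open>level 0\<close> the map is \<open>Phi 0\<close>, the identity; the
      half-width \<open>3/8\<close> leaves a collar of width \<open>1/8\<close>.\<close>
    show "\<exists>U. open U \<and> frontier unit_cube \<subseteq> U \<and> (\<forall>x\<in>U \<inter> unit_cube. Phi_lim x = x)"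
      using level_0_subset compact_imp_closed[OF compact_level[of 0]] Phi_lim_outside[of _ 0]
      by (intro exI[of _ "- level 0"]) (auto simp: frontier_def)
    show "Phi_lim ` A = A"
      using Phi_lim_cantor_cube Phi_lim_Psi unfolding A_def
      by (metis (no_types, lifting) image_iff subsetI subset_antisym)
    show "measure lebesgue A = (1/2) ^ CARD('n)"
      by (simp add: A_def measure_cantor_cube)
    show "\<forall>x\<in>A. Phi_lim x = reflection x"
      by (simp add: A_def Phi_lim_def)
  qed (simp_all add: A_def lusin_N_Phi_lim compact_cantor_cube cantor_cube_subset
      smooth_diffeomorphism_Phi_lim)
qed

end
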